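(* Let $\emptyset\ne \Omega \subset \mathbb{R}$ be open, let $p\in\mathbb{N}\cup\{\infty\}$, and let $\psi \in C^{p} (\Omega, \Omega)$ and $\omega \in C^{p} (\Omega, \mathbb{K})$. Let $C_{\omega,\psi}:C^p(\Omega,\mathbb{K})\to C^p(\Omega,\mathbb{K})$, $f\mapsto \omega\cdot(f\circ\psi)$. Then $C_{\omega, \psi}$ is supercyclic on $C^{p} (\Omega, \mathbb{K})$ if and only if it is mixing, and if and only if it is chaotic.
   Context: $\mathbb{K}$ is $\mathbb{R}$ or $\mathbb{C}$; $\mathbb{N}$ is the set of positive integers and $\mathbb{N}_0=\mathbb{N}\cup\{0\}$. For $p\in\mathbb{N}\cup\{\infty\}$, $C^p(\Omega,\mathbb{K})$ is the separable Fréchet space of functions $f:\Omega\to\mathbb{K}$ all of whose derivatives of order at most $p$ (of every order, if $p=\infty$) exist and are continuous, with the seminorms $\|f\|_{K,n}=\max_{k\le n}\max_{x\in K}|f^{(k)}(x)|$, $K\subset\Omega$ compact, $n\in\mathbb{N}_0$, $n\le p$. $C^p(\Omega,\Omega)$ is the set of maps $\Omega\to\Omega$ that belong to $C^p(\Omega,\mathbb{R})$. Let $T$ be an operator (continuous linear self-map) on a separable Fréchet space $X$ over $\mathbb{K}$. $T$ is supercyclic if there is $g\in X$ such that $\{\lambda T^ng: n\in\mathbb{N}_0,\lambda\in\mathbb{K}\}$ is dense in $X$. $T$ is transitive (respectively, mixing) if for all non-empty open $U,V\subset X$, $T^n(U)\cap V\neq\emptyset$ for some $n$ (respectively, for all large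 $n$). $T$ is chaotic if it is transitive and its set of periodic points $\bigcup_{n\in\mathbb{N}}\ker(T^n-I)$ is dense in $X$. *)

theory Defs
  imports "HOL-Analysis.Analysis" "HOL-Library.Extended_Nat"
begin

section \<open>Spaces of \<open>p\<close> times continuously differentiable functions\<close>

definition nderiv :: "nat \<Rightarrow> (real \<Rightarrow> 'k::real_normed_vector) \<Rightarrow> real \<Rightarrow> 'k" where
  "nderiv k f = ((\<lambda>g x. vector_derivative g (at x)) ^^ k) f"

text \<open>For open \<open>\<Omega>\<close> this depends only on the restriction of \<open>f\<close> to \<open>\<Omega>\<close>. The first conjunct
  gives the existence of the derivatives of order at most \<open>p\<close>, since \<^const>\<open>vector_derivative\<close>
  is a total function.\<close>

definition Cp_on :: "enat \<Rightarrow> real set \<Rightarrow> (real \<Rightarrow> 'k::real_normed_vector) \<Rightarrow> bool" where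
  "Cp_on p \<Omega> f \<longleftrightarrow>
     (\<forall>k. enat k < p \<longrightarrow> (\<forall>x\<in>\<Omega>. nderiv k f differentiable (at x))) \<and>
     (\<forall>k. enat k \<le> p \<longrightarrow> continuous_on \<Omega> (nderiv k f))"

text \<open>A function on \<open>\<Omega>\<close> is represented by its extension by \<open>0\<close>, so that equality of elements is
  equality on \<open>\<Omega>\<close> and the vector space operations are pointwise.\<close>

definition Cp_space :: "enat \<Rightarrow> real set \<Rightarrow> (real \<Rightarrow> 'k::real_normed_vector) set" where
  "Cp_space p \<Omega> = {f. Cp_on p \<Omega> f \<and> (\<forall>x. x \<notin> \<Omega> \<longrightarrow> f x = 0)}"

definition Cp_seminorm :: "real set \<Rightarrow> nat \<Rightarrow> (real \<Rightarrow> 'k::real_normed_vector) \<Rightarrow> real" where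
  "Cp_seminorm K n f = (MAX k\<in>{..n}. SUP x\<in>K. norm (nderiv k f x))"

text \<open>Compact sets are taken non-empty because the supremum of the empty set of reals is
  unspecified.\<close>

definition Cp_topology :: "enat \<Rightarrow> real set \<Rightarrow> (real \<Rightarrow> 'k::real_normed_vector) topology" where
  "Cp_topology p \<Omega> = topology_generated_by
     {{g \<in> Cp_space p \<Omega>. Cp_seminorm K n (\<lambda>x. g x - f x) < \<epsilon>} | f K n \<epsilon>.
        f \<in> Cp_space p \<Omega> \<and> compact K \<and> K \<noteq> {} \<and> K \<subseteq> \<Omega> \<and> enat n \<le> p \<and> \<epsilon> > 0}"

lemma nderiv_zero [simp]: "nderiv k (\<lambda>x. 0) = (\<lambda>x. 0)"
  by (induction k) (simp_all add: nderiv_def)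

lemma topspace_Cp_topology:
  fixes \<Omega> :: "real set"
  assumes "\<Omega> \<noteq> {}"
  shows "topspace (Cp_topology p \<Omega>) = (Cp_space p \<Omega> :: (real \<Rightarrow> 'k::real_normed_vector) set)"
proof
  show "topspace (Cp_topology p \<Omega>) \<subseteq> (Cp_space p \<Omega> :: (real \<Rightarrow> 'k) set)"
    unfolding Cp_topology_def topology_generated_by_topspace by blast
  show "(Cp_space p \<Omega> :: (real \<Rightarrow> 'k) set) \<subseteq> topspace (Cp_topology p \<Omega>)"
  proof
    fix f :: "real \<Rightarrow> 'k" assume f: "f \<in> Cp_space p \<Omega>"
    obtain a where a: "a \<in> \<Omega>" using assms by blast
    have s: "Cp_seminorm {a} 0 (\<lambda>x. f x - f x) < 1"
      by (simp add: Cp_seminorm_def)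
    have "enat 0 \<le> p" by (simp add: zero_enat_def[symmetric])
    then have "\<exists>h K n \<epsilon>. {g \<in> Cp_space p \<Omega>. Cp_seminorm {a} 0 (\<lambda>x. g x - f x) < 1} =
          {g \<in> Cp_space p \<Omega>. Cp_seminorm K n (\<lambda>x. g x - h x) < \<epsilon>} \<and>
          h \<in> Cp_space p \<Omega> \<and> compact K \<and> K \<noteq> {} \<and> K \<subseteq> \<Omega> \<and> enat n \<le> p \<and> \<epsilon> > 0"
      using f a by (intro exI[of _ f] exI[of _ "{a}"] exI[of _ "0::nat"] exI[of _ "1::real"]) simp
    then show "f \<in> topspace (Cp_topology p \<Omega>)"
      unfolding Cp_topology_def topology_generated_by_topspace using f s by blast
  qed
qed

definition weighted_comp ::
    "real set \<Rightarrow> (real \<Rightarrow> 'k::real_normed_field) \<Rightarrow> (real \<Rightarrow> real) \<Rightarrow> (real \<Rightarrow> 'k) \<Rightarrow> real \<Rightarrow> 'k" where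
  "weighted_comp \<Omega> \<omega> \<psi> f = (\<lambda>x. if x \<in> \<Omega> then \<omega> x * f (\<psi> x) else 0)"

section \<open>Linear dynamics\<close>

text \<open>The space is the carrier of the topology \<open>X\<close>; \<open>smul\<close> is its scalar multiplication.\<close>

definition supercyclic_on :: "'a topology \<Rightarrow> ('k \<Rightarrow> 'a \<Rightarrow> 'a) \<Rightarrow> ('a \<Rightarrow> 'a) \<Rightarrow> bool" where
  "supercyclic_on X smul T \<longleftrightarrow>
     (\<exists>g\<in>topspace X. X closure_of {smul c ((T ^^ n) g) | c n. True} = topspace X)"

definition transitive_on :: "'a topology \<Rightarrow> ('a \<Rightarrow> 'a) \<Rightarrow> bool" where
  "transitive_on X T \<longleftrightarrow>
     (\<forall>U V. openin X U \<and> U \<noteq> {} \<and> openin X V \<and> V \<noteq> {} \<longrightarrow>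
        (\<exists>n. (T ^^ n) ` U \<inter> V \<noteq> {}))"

definition mixing_on :: "'a topology \<Rightarrow> ('a \<Rightarrow> 'a) \<Rightarrow> bool" where
  "mixing_on X T \<longleftrightarrow>
     (\<forall>U V. openin X U \<and> U \<noteq> {} \<and> openin X V \<and> V \<noteq> {} \<longrightarrow>
        (\<exists>N. \<forall>n\<ge>N. (T ^^ n) ` U \<inter> V \<noteq> {}))"

definition periodic_points :: "'a topology \<Rightarrow> ('a \<Rightarrow> 'a) \<Rightarrow> 'a set" where
  "periodic_points X T = (\<Union>n\<in>{1..}. {f \<in> topspace X. (T ^^ n) f = f})"

definition chaotic_on :: "'a topology \<Rightarrow> ('a \<Rightarrow> 'a) \<Rightarrow> bool" where
  "chaotic_on X T \<longleftrightarrow>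
     transitive_on X T \<and> X closure_of (periodic_points X T) = topspace X"

abbreviation fun_scale :: "'k::times \<Rightarrow> (real \<Rightarrow> 'k) \<Rightarrow> real \<Rightarrow> 'k" where
  "fun_scale c f \<equiv> (\<lambda>x. c * f x)"

end

(*
The operator is shown to be supercyclic, mixing and chaotic exactly when omega has no zeros and psi
is injective, has nowhere vanishing derivative and no periodic points.

Necessity: on the orbit of a supercyclic vector, or of a suitable open set if the operator is
transitive, the quotient of two continuous functionals must take values in every nonempty open set of
scalars.  If one of the conditions fails, the quotient f(y)/f(x) or f'(x)/f(x) transforms along orbits
trivially or, at a fixed point of psi, by an affine map z |-> c + a z with real a, and its values miss
an open set.

Sufficiency: a map psi without periodic points moves every compact set off itself, because every
component that is visited infinitely often is mapped into itself by an iterate without fixed points.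
Cutting off with smooth functions and transporting along the iterates of psi then gives functions
with prescribed disjointly supported pieces.  Two pieces give mixing, a two-sided sum over a single
orbit gives periodic points, and a sum over a countable dense set of polynomials gives a hypercyclic
vector, so that no category argument is needed.
*)

theory Submission
  imports Defs
begin

section \<open>Functions of class \<open>C\<^sup>p\<close>\<close>

text \<open>Supercyclicity speaks of one vector, transitivity of an open set of vectors; the
  necessity half is shaped by the wish to treat both at once. Quotients of functionals remove the
  free scalar of supercyclicity. For transitivity, however, the quotient may start anywhere in an
  open set, and an expanding affine map spreads any neighbourhood of its fixed point over all
  scalars. Hence the starting values are confined to a set that may be chosen: one value for a
  supercyclic vector, a bounded open set away from the fixed point for a transitive operator.

  In the sufficiency half every construction starts with a cutoff, because only functions with
  compact support in \<open>\<Omega>\<close> can be transported forward along \<open>\<psi>\<close>.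
  Since compact sets leave every compact set for good, the cross terms vanish identically near the
  compact set in question instead of becoming small; all sums are locally finite and no convergence
  has to be discussed.\<close>

lemma nderiv_0 [simp]: "nderiv 0 f = f"
  by (simp add: nderiv_def)

text \<open>The definition iterates on the outside. Splitting a derivative off on the inside suits
  inductions on the order that generalise over \<open>f\<close>.\<close>

lemma nderiv_Suc: "nderiv (Suc k) f = nderiv k (\<lambda>x. vector_derivative f (at x))"
  by (simp add: nderiv_def funpow_Suc_right del: funpow.simps)

lemma nderiv_Suc': "nderiv (Suc k) f = (\<lambda>x. vector_derivative (nderiv k f) (at x))"
  by (simp add: nderiv_def)

lemma vector_derivative_cong_open:
  assumes "open S" "x \<in> S" "\<And>y. y \<in> S \<Longrightarrow> f y = g y"
  shows "vector_derivative f (at x) = vector_derivative g (at x)"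
proof (rule vector_derivative_cong_eq)
  show "\<forall>\<^sub>F y in nhds x. y \<in> UNIV \<longrightarrow> f y = g y"
    using assms by (auto simp: eventually_nhds)
qed auto

lemma nderiv_cong_open:
  assumes "open S" "x \<in> S" "\<And>y. y \<in> S \<Longrightarrow> f y = g y"
  shows "nderiv k f x = nderiv k g x"
  using assms(2,3)
proof (induction k arbitrary: f g x)
  case (Suc k)
  have "nderiv k (\<lambda>x. vector_derivative f (at x)) x = nderiv k (\<lambda>x. vector_derivative g (at x)) x"
    by (rule Suc.IH[OF Suc.prems(1)], rule vector_derivative_cong_open[OF assms(1)])
       (use Suc.prems in auto)
  then show ?case by (simp add: nderiv_Suc)
qed simp

lemma differentiable_cong_open:
  assumes "open S" "x \<in> S" "\<And>y. y \<in> S \<Longrightarrow> f y = g y" "f differentiable (at x)"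
  shows "g differentiable (at x)"
proof -
  obtain D where "(f has_derivative D) (at x)" using assms(4) unfolding differentiable_def by blast
  then have "(g has_derivative D) (at x)"
    by (rule has_derivative_transform_within_open[OF _ assms(1,2)]) (use assms(3) in auto)
  then show ?thesis unfolding differentiable_def by blast
qed

lemma Cp_on_mono: "Cp_on p S f \<Longrightarrow> q \<le> p \<Longrightarrow> T \<subseteq> S \<Longrightarrow> Cp_on q T f"
  unfolding Cp_on_def
proof (intro conjI allI impI; elim conjE)
  fix k assume *: "\<forall>k. enat k < p \<longrightarrow> (\<forall>x\<in>S. nderiv k f differentiable at x)"
    "q \<le> p" "T \<subseteq> S" "enat k < q"
  then have "enat k < p" by order
  with * show "\<forall>x\<in>T. nderiv k f differentiable at x" by blast
next
  fix k assume *: "\<forall>k. enat k \<le> p \<longrightarrow> continuous_on S (nderiv k f)"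
    "q \<le> p" "T \<subseteq> S" "enat k \<le> q"
  then have "enat k \<le> p" by order
  with * show "continuous_on T (nderiv k f)" using continuous_on_subset by blast
qed

text \<open>Reduces every closure property to finite order, where induction is available, and so
  covers \<open>p = \<infinity>\<close>.\<close>

lemma Cp_on_iff:
  "Cp_on p S f \<longleftrightarrow> (\<forall>n. enat n \<le> p \<longrightarrow> Cp_on (enat n) S f)"
proof
  assume "Cp_on p S f"
  then show "\<forall>n. enat n \<le> p \<longrightarrow> Cp_on (enat n) S f"
    by (auto intro: Cp_on_mono)
next
  assume *: "\<forall>n. enat n \<le> p \<longrightarrow> Cp_on (enat n) S f"
  \<comment> \<open>Order \<open>k\<close> only gives continuity of the \<open>k\<close>-th
    derivative; its differentiability is read off at order \<open>Suc k\<close>.\<close>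
  have "enat (Suc k) \<le> p" if "enat k < p" for k
    using that by (simp add: Suc_ile_eq)
  with * have "\<forall>x\<in>S. nderiv k f differentiable (at x)" if "enat k < p" for k
    using that unfolding Cp_on_def by (metis enat_ord_simps(2) lessI)
  moreover have "continuous_on S (nderiv k f)" if "enat k \<le> p" for k
    using * that unfolding Cp_on_def by blast
  ultimately show "Cp_on p S f" unfolding Cp_on_def by blast
qed

lemma Cp_on_0: "Cp_on (enat 0) S f \<longleftrightarrow> continuous_on S f"
  by (auto simp: Cp_on_def)

lemma Cp_on_continuous: "Cp_on p S f \<Longrightarrow> continuous_on S f"
  using Cp_on_0 Cp_on_mono[of p S f "enat 0" S] by (auto simp: zero_enat_def[symmetric])

lemma Cp_on_Suc:
  assumes "open S"
  shows "Cp_on (enat (Suc n)) S f \<longleftrightarrow>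
    (\<forall>x\<in>S. f differentiable (at x)) \<and> Cp_on (enat n) S (\<lambda>x. vector_derivative f (at x))"
    (is "?L \<longleftrightarrow> ?R")
proof
  assume L: ?L
  have "(\<forall>k. Suc k < Suc n \<longrightarrow> (\<forall>x\<in>S. nderiv (Suc k) f differentiable (at x)))"
       "(\<forall>k. Suc k \<le> Suc n \<longrightarrow> continuous_on S (nderiv (Suc k) f))"
       "\<forall>x\<in>S. nderiv 0 f differentiable (at x)"
    using L unfolding Cp_on_def by auto
  then show ?R by (auto simp: Cp_on_def nderiv_Suc)
next
  assume R: ?R
  then have "continuous_on S f"
    by (meson continuous_at_imp_continuous_on differentiable_imp_continuous_within)
  then show ?L
    using R unfolding Cp_on_def
    by (auto simp: nderiv_Suc less_Suc_eq_0_disj less_Suc_eq_le[symmetric])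
qed

lemma Cp_on_has_vector_derivative:
  assumes "Cp_on p S f" "x \<in> S" "p \<ge> 1"
  shows "(f has_vector_derivative vector_derivative f (at x)) (at x)"
proof -
  have "enat 0 < p" using assms(3) by (simp add: Suc_ile_eq one_enat_def)
  then have "nderiv 0 f differentiable (at x)"
    using assms unfolding Cp_on_def by blast
  then show ?thesis by (simp add: vector_derivative_works)
qed

text \<open>Gluing, for functions described differently on different open sets: push-forwards,
  locally finite sums, and cut off functions extended by zero to the line.\<close>

lemma Cp_on_local:
  assumes "open S" and "\<And>x. x \<in> S \<Longrightarrow> \<exists>U g. open U \<and> x \<in> U \<and> Cp_on p U g \<and> (\<forall>y\<in>U. f y = g y)"
  shows "Cp_on p S f"
  unfolding Cp_on_def
proof (intro conjI allI impI ballI)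
  fix k x assume k: "enat k < p" and x: "x \<in> S"
  obtain U g where U: "open U" "x \<in> U" "Cp_on p U g" "\<forall>y\<in>U. f y = g y" using assms(2)[OF x] by blast
  have "nderiv k g differentiable (at x)" using U k by (auto simp: Cp_on_def)
  then show "nderiv k f differentiable (at x)"
    using U nderiv_cong_open[of U _ f g k] differentiable_cong_open[of U x "nderiv k g" "nderiv k f"] by auto
next
  fix k assume k: "enat k \<le> p"
  have "continuous (at x) (nderiv k f)" if x: "x \<in> S" for x
  proof -
    obtain U g where U: "open U" "x \<in> U" "Cp_on p U g" "\<forall>y\<in>U. f y = g y" using assms(2)[OF x] by blast
    have "continuous_on U (nderiv k g)" using U k by (auto simp: Cp_on_def)
    then have "continuous_on U (nderiv k f)"
      using U nderiv_cong_open[of U _ f g k] continuous_on_cong by (metis (no_types, lifting))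
    then show ?thesis using U continuous_on_eq_continuous_at by blast
  qed
  then show "continuous_on S (nderiv k f)" by (simp add: continuous_at_imp_continuous_on)
qed

lemma Cp_on_cong:
  assumes "open S" "\<And>x. x \<in> S \<Longrightarrow> f x = g x" "Cp_on p S f"
  shows "Cp_on p S g"
  using Cp_on_local[of S p g] assms by metis

text \<open>The induction step of the closure lemmas: a formula for the derivative is supplied, and
  the induction hypothesis is applied to that formula.\<close>

lemma Cp_on_Suc_I:
  assumes "open S" "\<And>x. x \<in> S \<Longrightarrow> (f has_vector_derivative f' x) (at x)" "Cp_on (enat n) S f'"
  shows "Cp_on (enat (Suc n)) S f"
proof -
  have "vector_derivative f (at x) = f' x" if "x \<in> S" for x
    using assms that by (simp add: vector_derivative_at)
  then have "Cp_on (enat n) S (\<lambda>x. vector_derivative f (at x))"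
    using Cp_on_cong[OF assms(1) _ assms(3)] by simp
  then show ?thesis
    using assms Cp_on_Suc differentiableI_vector by blast
qed

lemma Cp_on_SucD:
  assumes "open S" "Cp_on (enat (Suc n)) S f"
  shows "\<And>x. x \<in> S \<Longrightarrow> (f has_vector_derivative vector_derivative f (at x)) (at x)"
    "Cp_on (enat n) S (\<lambda>x. vector_derivative f (at x))" "Cp_on (enat n) S f"
  using assms Cp_on_Suc[of S n f] Cp_on_mono[of "enat (Suc n)" S f "enat n" S]
  by (auto simp: vector_derivative_works)

section \<open>Closure under algebraic operations, composition and inversion\<close>

lemma Cp_on_const [simp]: "open S \<Longrightarrow> Cp_on p S (\<lambda>x. c)"
proof -
  assume S: "open S"
  have "nderiv k (\<lambda>x. c) = (\<lambda>x. if k = 0 then c else 0)" for k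
    by (cases k) (simp_all add: nderiv_Suc)
  then show ?thesis by (auto simp: Cp_on_def intro!: differentiableI_vector)
qed

lemma Cp_on_ident: "open S \<Longrightarrow> Cp_on p S (\<lambda>x. x)"
proof (subst Cp_on_iff, intro allI impI)
  fix n assume S: "open S"
  show "Cp_on (enat n) S (\<lambda>x. x)"
  proof (cases n)
    case (Suc m)
    show ?thesis unfolding Suc
      by (rule Cp_on_Suc_I[OF S, where f' = "\<lambda>_. 1"]) (auto simp: S)
  qed (simp add: Cp_on_0)
qed

lemma Cp_on_add:
  assumes S: "open S" and "Cp_on p S f" "Cp_on p S g"
  shows "Cp_on p S (\<lambda>x. f x + g x)"
proof -
  have *: "Cp_on (enat n) S f \<Longrightarrow> Cp_on (enat n) S g \<Longrightarrow> Cp_on (enat n) S (\<lambda>x. f x + g x)" for n f g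
  proof (induction n arbitrary: f g)
    case 0 then show ?case by (simp add: Cp_on_0 continuous_on_add)
  next
    case (Suc n)
    show ?case
      by (rule Cp_on_Suc_I[OF S has_vector_derivative_add Suc.IH]) (use Cp_on_SucD[OF S] Suc.prems in auto)
  qed
  show ?thesis
    by (subst Cp_on_iff, intro allI impI * Cp_on_mono[OF assms(2)] Cp_on_mono[OF assms(3)] order_refl)
qed

text \<open>One induction for both the product of scalars and scaling by a real function.\<close>

lemma (in bounded_bilinear) Cp_on_prod:
  assumes S: "open S" and "Cp_on p S f" "Cp_on p S g"
  shows "Cp_on p S (\<lambda>x. prod (f x) (g x))"
proof -
  have *: "Cp_on (enat n) S f \<Longrightarrow> Cp_on (enat n) S g \<Longrightarrow> Cp_on (enat n) S (\<lambda>x. prod (f x) (g x))" for n f g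
  proof (induction n arbitrary: f g)
    case 0 then show ?case by (simp add: Cp_on_0 continuous_on)
  next
    case (Suc n)
    note D = Cp_on_SucD[OF S Suc.prems(1)] Cp_on_SucD[OF S Suc.prems(2)]
    show ?case
      by (rule Cp_on_Suc_I[OF S has_vector_derivative Cp_on_add[OF S Suc.IH Suc.IH]]) (use D in auto)
  qed
  show ?thesis
    by (subst Cp_on_iff, intro allI impI * Cp_on_mono[OF assms(2)] Cp_on_mono[OF assms(3)] order_refl)
qed

lemmas Cp_on_mult = bounded_bilinear.Cp_on_prod[OF bounded_bilinear_mult]
lemmas Cp_on_scaleR = bounded_bilinear.Cp_on_prod[OF bounded_bilinear_scaleR]

lemma Cp_on_diff:
  assumes S: "open S" and "Cp_on p S f" "Cp_on p S g"
  shows "Cp_on p S (\<lambda>x. f x - g x)"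
  using Cp_on_add[OF S assms(2) Cp_on_scaleR[OF S Cp_on_const[OF S, where c = "-1"] assms(3)]]
  by simp

lemma Cp_on_sum:
  assumes S: "open S" and "\<And>i. i \<in> I \<Longrightarrow> Cp_on p S (f i)"
  shows "Cp_on p S (\<lambda>x. \<Sum>i\<in>I. f i x)"
  using assms(2) by (induction I rule: infinite_finite_induct) (auto simp: S Cp_on_add)

lemma Cp_on_prod_set:
  fixes f :: "'i \<Rightarrow> real \<Rightarrow> 'a::real_normed_field"
  assumes S: "open S" and "\<And>i. i \<in> I \<Longrightarrow> Cp_on p S (f i)"
  shows "Cp_on p S (\<lambda>x. \<Prod>i\<in>I. f i x)"
  using assms(2) by (induction I rule: infinite_finite_induct) (auto simp: S Cp_on_mult)

lemma Cp_on_compose: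
  fixes g :: "real \<Rightarrow> real"
  assumes S: "open S" and T: "open T" and "g ` S \<subseteq> T" and "Cp_on p T f" "Cp_on p S g"
  shows "Cp_on p S (\<lambda>x. f (g x))"
proof -
  have *: "Cp_on (enat n) T f \<Longrightarrow> Cp_on (enat n) S g \<Longrightarrow> Cp_on (enat n) S (\<lambda>x. f (g x))" for n f
  proof (induction n arbitrary: f)
    case 0 then show ?case using assms(3) by (auto simp: Cp_on_0 intro: continuous_on_compose2)
  next
    case (Suc n)
    note D = Cp_on_SucD[OF T Suc.prems(1)] Cp_on_SucD[OF S Suc.prems(2)]
    show ?case
    proof (rule Cp_on_Suc_I[OF S])
      show "((\<lambda>x. f (g x)) has_vector_derivative
          vector_derivative g (at x) *\<^sub>R vector_derivative f (at (g x))) (at x)" if "x \<in> S" for x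
        using vector_diff_chain_at[of g _ x f, unfolded o_def] D(1) D(4) that assms(3) by blast
      show "Cp_on (enat n) S (\<lambda>x. vector_derivative g (at x) *\<^sub>R vector_derivative f (at (g x)))"
        by (rule Cp_on_scaleR[OF S D(5) Suc.IH]) (use D in auto)
    qed
  qed
  show ?thesis
    by (subst Cp_on_iff, intro allI impI, rule *[OF Cp_on_mono[OF assms(4)] Cp_on_mono[OF assms(5)]]) auto
qed

lemma Cp_on_inverse:
  fixes f :: "real \<Rightarrow> 'a::real_normed_field"
  assumes S: "open S" and "Cp_on p S f" and nz: "\<And>x. x \<in> S \<Longrightarrow> f x \<noteq> 0"
  shows "Cp_on p S (\<lambda>x. inverse (f x))"
proof -
  have *: "Cp_on (enat n) S f \<Longrightarrow> Cp_on (enat n) S (\<lambda>x. inverse (f x))" for n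
  proof (induction n)
    case 0 then show ?case using nz by (auto simp: Cp_on_0 intro: continuous_on_inverse)
  next
    case (Suc n)
    note D = Cp_on_SucD[OF S Suc.prems(1)]
    note I = Suc.IH[OF D(3)]
    show ?case
    proof (rule Cp_on_Suc_I[OF S])
      show "((\<lambda>x. inverse (f x)) has_vector_derivative
          0 - inverse (f x) * vector_derivative f (at x) * inverse (f x)) (at x)" if "x \<in> S" for x
        using D(1)[OF that] nz[OF that] unfolding has_vector_derivative_def
        by (auto intro!: derivative_eq_intros)
      show "Cp_on (enat n) S (\<lambda>x. 0 - inverse (f x) * vector_derivative f (at x) * inverse (f x))"
        by (intro Cp_on_diff Cp_on_mult I D Cp_on_const S)
    qed
  qed
  show ?thesis
    by (subst Cp_on_iff, intro allI impI * Cp_on_mono[OF assms(2)] order_refl)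
qed

text \<open>Invariance of domain gives the open image and the continuity of \<open>g\<close>. The
  formula g' = 1 / (f' o g) then raises the order of \<open>g\<close> by one in each induction
  step.\<close>

lemma Cp_on_inverse_function:
  fixes f g :: "real \<Rightarrow> real"
  assumes S: "open S" and f: "Cp_on p S f" and p: "p \<ge> 1"
    and nz: "\<And>x. x \<in> S \<Longrightarrow> vector_derivative f (at x) \<noteq> 0"
    and gf: "\<And>x. x \<in> S \<Longrightarrow> g (f x) = x"
  shows "open (f ` S)" "Cp_on p (f ` S) g"
proof -
  have inj: "inj_on f S" using gf by (metis inj_onI)
  have cf: "continuous_on S f" using f Cp_on_continuous by blast
  show oS: "open (f ` S)" using invariance_of_domain[OF cf S inj] .
  have "homeomorphism S (f ` S) f g"
  proof -
    obtain h where h: "homeomorphism S (f ` S) f h"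
      using invariance_of_domain_homeomorphism[OF S cf _ inj] by auto
    then have "h y = g y" if "y \<in> f ` S" for y
      using that gf by (auto simp: homeomorphism_def)
    then show ?thesis using h homeomorphism_cong by (metis (no_types, lifting))
  qed
  then have cg: "continuous_on (f ` S) g" by (simp add: homeomorphism_def)
  have dg: "(g has_vector_derivative inverse (vector_derivative f (at (g y)))) (at y)" if y: "y \<in> f ` S" for y
  proof -
    obtain x where x: "x \<in> S" "y = f x" using y by blast
    have "(f has_field_derivative vector_derivative f (at x)) (at x)"
      using Cp_on_has_vector_derivative[OF f x(1) p] by (simp add: has_real_derivative_iff_has_vector_derivative)
    then have "(g has_field_derivative inverse (vector_derivative f (at x))) (at (f x))"
      unfolding has_field_derivative_def
      using has_derivative_inverse_strong[OF S x(1) cf gf] nz[OF x(1)] by (fastforce simp: fun_eq_iff)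
    then show ?thesis using x gf by (simp add: has_real_derivative_iff_has_vector_derivative)
  qed
  have *: "Cp_on (enat n) S f \<Longrightarrow> Cp_on (enat n) (f ` S) g" for n
  proof (induction n)
    case 0 then show ?case using cg by (simp add: Cp_on_0)
  next
    case (Suc n)
    note D = Cp_on_SucD[OF S Suc.prems(1)]
    have "Cp_on (enat n) (f ` S) (\<lambda>y. vector_derivative f (at (g y)))"
      by (rule Cp_on_compose[OF oS S _ D(2) Suc.IH[OF D(3)]]) (use gf in auto)
    then have "Cp_on (enat n) (f ` S) (\<lambda>y. inverse (vector_derivative f (at (g y))))"
      by (rule Cp_on_inverse[OF oS]) (use gf nz in auto)
    then show ?case using Cp_on_Suc_I[OF oS dg] by blast
  qed
  show "Cp_on p (f ` S) g"
    by (subst Cp_on_iff, intro allI impI * Cp_on_mono[OF f] order_refl)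
qed

lemma nderiv_diff:
  assumes S: "open S" and "Cp_on p S f" "Cp_on p S g" "x \<in> S" "enat k \<le> p"
  shows "nderiv k (\<lambda>x. f x - g x) x = nderiv k f x - nderiv k g x"
proof -
  have "Cp_on (enat k) S f" "Cp_on (enat k) S g" using assms Cp_on_iff by blast+
  then show ?thesis using assms(4)
  proof (induction k arbitrary: f g x)
    case (Suc k)
    note D = Cp_on_SucD[OF S Suc.prems(1)] Cp_on_SucD[OF S Suc.prems(2)]
    have "nderiv k (\<lambda>x. vector_derivative (\<lambda>x. f x - g x) (at x)) x =
      nderiv k (\<lambda>x. vector_derivative f (at x) - vector_derivative g (at x)) x"
      by (rule nderiv_cong_open[OF S Suc.prems(3)])
         (use D in \<open>auto intro!: vector_derivative_at has_vector_derivative_diff\<close>)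
    also have "\<dots> = nderiv (Suc k) f x - nderiv (Suc k) g x"
      unfolding nderiv_Suc using Suc.IH D Suc.prems by blast
    finally show ?case by (simp add: nderiv_Suc)
  qed simp
qed

section \<open>Smooth cutoff functions\<close>

text \<open>The functions P(1/x) exp(-1/x), extended by zero to x <= 0. The polynomial is a
  parameter because the resulting family is closed under differentiation, which makes smoothness an
  easy induction.\<close>

definition flat :: "real poly \<Rightarrow> real \<Rightarrow> real" where
  "flat P x = (if x > 0 then poly P (1 / x) * exp (- (1 / x)) else 0)"

lemma poly_times_exp_tendsto_0: "((\<lambda>y::real. poly P y * exp (- y)) \<longlongrightarrow> 0) at_top"
proof -
  have "((\<lambda>y::real. \<Sum>i\<le>degree P. coeff P i * (y ^ i / exp y)) \<longlongrightarrow> (\<Sum>i\<le>degree P. coeff P i * 0)) at_top"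
    by (intro tendsto_sum tendsto_mult tendsto_const tendsto_power_div_exp_0)
  then show ?thesis
    by (simp add: poly_altdef exp_minus divide_inverse sum_distrib_right mult.assoc)
qed

text \<open>With y = 1/x one has d/dx = -y^2 d/dy, which turns P(y) exp(-y) into y^2 (P - P')(y)
  exp(-y); \<open>[:0,0,1:]\<close> is y^2.\<close>

lemma flat_has_vector_derivative:
  "(flat P has_vector_derivative flat ([:0,0,1:] * (P - pderiv P)) x) (at x)"
proof -
  consider "x > 0" | "x < 0" | "x = 0" by linarith
  then have "(flat P has_field_derivative flat ([:0,0,1:] * (P - pderiv P)) x) (at x)"
  proof cases
    case 1
    have "((\<lambda>x. poly P (1 / x) * exp (- (1 / x))) has_field_derivative
        flat ([:0,0,1:] * (P - pderiv P)) x) (at x)"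
      using 1 by (auto intro!: derivative_eq_intros simp: flat_def field_simps power2_eq_square)
    then show ?thesis
      by (rule has_field_derivative_transform_within_open[where S = "{0<..}"]) (use 1 in \<open>auto simp: flat_def\<close>)
  next
    case 2
    have "((\<lambda>x. 0) has_field_derivative flat ([:0,0,1:] * (P - pderiv P)) x) (at x)"
      using 2 by (simp add: flat_def)
    then show ?thesis
      by (rule has_field_derivative_transform_within_open[where S = "{..<0}"]) (use 2 in \<open>auto simp: flat_def\<close>)
  next
    case 3
    \<comment> \<open>The difference quotient at 0 carries an extra factor 1/y, which becomes
      \<open>[:0,1:]\<close> in the variable 1/y.\<close>
    have "((\<lambda>y. poly ([:0,1:] * P) (inverse y) * exp (- inverse y)) \<longlongrightarrow> 0) (at_right 0)"
      using filterlim_compose[OF poly_times_exp_tendsto_0 filterlim_inverse_at_top_right] .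
    then have "((\<lambda>y. flat P y / y) \<longlongrightarrow> 0) (at_right 0)"
      by (rule Lim_transform_eventually)
         (auto simp: eventually_at_filter flat_def field_simps intro!: always_eventually)
    moreover have "((\<lambda>y. flat P y / y) \<longlongrightarrow> 0) (at_left 0)"
      by (rule Lim_transform_eventually[OF tendsto_const])
         (auto simp: eventually_at_filter flat_def intro!: always_eventually)
    ultimately show ?thesis
      using 3 by (auto simp: has_field_derivative_iff filterlim_split_at flat_def)
  qed
  then show ?thesis by (simp add: has_real_derivative_iff_has_vector_derivative)
qed

lemma Cp_on_flat: "Cp_on p UNIV (flat P)"
proof (subst Cp_on_iff, intro allI impI)
  fix n show "Cp_on (enat n) UNIV (flat P)"
  proof (induction n arbitrary: P)
    case 0
    show ?case unfolding Cp_on_0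
      using flat_has_vector_derivative has_vector_derivative_continuous
      by (metis continuous_at_imp_continuous_on)
  next
    case (Suc n)
    then show ?case using Cp_on_Suc_I[OF open_UNIV flat_has_vector_derivative] by blast
  qed
qed

lemma flat_1: "flat 1 x \<ge> 0" "flat 1 x = 0 \<longleftrightarrow> x \<le> 0" "flat 1 x > 0 \<longleftrightarrow> x > 0"
  by (auto simp: flat_def)

text \<open>The value 1 is attained on an open neighbourhood \<open>W\<close>, not just on
  \<open>K\<close>, so that multiplication by \<open>h\<close> leaves all derivatives on
  \<open>K\<close> unchanged.\<close>

lemma smooth_cutoff:
  fixes K S :: "real set"
  assumes K: "compact K" and S: "open S" and "K \<subseteq> S"
  shows "\<exists>(h :: real \<Rightarrow> real) L W. (\<forall>p. Cp_on p UNIV h) \<and> compact L \<and> L \<subseteq> S \<and>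
    open W \<and> K \<subseteq> W \<and> (\<forall>x\<in>W. h x = 1) \<and> (\<forall>x. x \<notin> L \<longrightarrow> h x = 0)"
proof (cases "K = {}")
  case True
  then show ?thesis by (intro exI[of _ "\<lambda>_. 0"] exI[of _ "{}"]) auto
next
  case False
  have "\<exists>r>0. cball x r \<subseteq> S" if "x \<in> K" for x
    using that assms open_contains_cball by blast
  then obtain r where r: "\<And>x. x \<in> K \<Longrightarrow> r x > 0" "\<And>x. x \<in> K \<Longrightarrow> cball x (r x) \<subseteq> S" by metis
  have "K \<subseteq> (\<Union>x\<in>K. ball x (r x))" using r by auto
  then obtain D where D: "D \<subseteq> K" "finite D" "K \<subseteq> (\<Union>x\<in>D. ball x (r x))"
    using compactE_image[OF K, of K "\<lambda>x. ball x (r x)"] by auto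
  \<comment> \<open>Each summand is positive exactly on one ball of a finite cover of
    \<open>K\<close>, so \<open>B\<close> is positive on \<open>K\<close> and zero off the closed
    balls.\<close>
  define B where "B = (\<lambda>y. \<Sum>x\<in>D. flat 1 ((r x)\<^sup>2 - (y - x)\<^sup>2))"
  have B: "Cp_on p UNIV B" for p
    unfolding B_def power2_eq_square
    by (intro Cp_on_sum Cp_on_compose[OF open_UNIV open_UNIV _ Cp_on_flat]
        Cp_on_diff Cp_on_mult Cp_on_const Cp_on_ident open_UNIV) auto
  then have contB: "continuous_on T B" for T
    using Cp_on_continuous continuous_on_subset by blast
  have B0: "B y \<ge> 0" for y unfolding B_def by (intro sum_nonneg flat_1)
  have sq: "(r x)\<^sup>2 - (y - x)\<^sup>2 > 0 \<longleftrightarrow> y \<in> ball x (r x)" if "x \<in> D" for x y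
  proof -
    have "r x > 0" using that D r by blast
    moreover have "(r x)\<^sup>2 \<le> (y - x)\<^sup>2 \<longleftrightarrow> \<bar>r x\<bar> \<le> \<bar>y - x\<bar>"
      by (rule abs_le_square_iff[symmetric])
    ultimately show ?thesis by (auto simp: dist_real_def abs_minus_commute)
  qed
  have Bpos: "B y > 0" if y: "y \<in> K" for y
  proof -
    obtain x where x: "x \<in> D" "y \<in> ball x (r x)" using y D by blast
    show ?thesis unfolding B_def
      by (rule sum_pos2[OF D(2) x(1)]) (use sq x in \<open>auto simp: flat_1\<close>)
  qed
  obtain z where z: "z \<in> K" "\<And>y. y \<in> K \<Longrightarrow> B z \<le> B y"
    using continuous_attains_inf[OF K False contB] by blast
  \<comment> \<open>Half of the minimum of \<open>B\<close> on \<open>K\<close>: then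
    \<open>B > \<delta>\<close> is an open condition that holds on \<open>K\<close>.\<close>
  define \<delta> where "\<delta> = B z / 2"
  have \<delta>: "\<delta> > 0" "\<And>y. y \<in> K \<Longrightarrow> B y > \<delta>" using Bpos z unfolding \<delta>_def by fastforce+
  \<comment> \<open>Where \<open>B > \<delta>\<close> the second summand of the denominator vanishes
    and the quotient is 1; where \<open>B = 0\<close> the numerator vanishes. Since
    \<open>\<delta> > 0\<close>, both summands never vanish together.\<close>
  define h where "h = (\<lambda>y. flat 1 (B y) * inverse (flat 1 (B y) + flat 1 (\<delta> - B y)))"
  have pos: "flat 1 (B y) + flat 1 (\<delta> - B y) > 0" for y
  proof (cases "B y > 0")
    case True then show ?thesis by (simp add: flat_1 add_pos_nonneg)
  next
    case False then show ?thesis using \<delta> by (simp add: flat_1 add_nonneg_pos)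
  qed
  show ?thesis
  proof (rule exI[of _ h], rule exI[of _ "\<Union>x\<in>D. cball x (r x)"], rule exI[of _ "{y. \<delta> < B y}"],
      intro conjI allI ballI impI)
    show "Cp_on p UNIV h" for p
    proof -
      have "Cp_on p UNIV (\<lambda>y. flat 1 (g y))" if "Cp_on p UNIV g" for g
        using Cp_on_compose[OF open_UNIV open_UNIV _ Cp_on_flat that] by simp
      note 1 = this[OF B] and 2 = this[OF Cp_on_diff[OF open_UNIV Cp_on_const[OF open_UNIV, where c = \<delta>] B]]
      have "flat 1 (B y) + flat 1 (\<delta> - B y) \<noteq> 0" for y using pos[of y] by simp
      then show ?thesis unfolding h_def
        using Cp_on_mult[OF open_UNIV 1 Cp_on_inverse[OF open_UNIV Cp_on_add[OF open_UNIV 1 2]]] by blast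
    qed
    show "compact (\<Union>x\<in>D. cball x (r x))" using D(2) by (intro compact_UN) auto
    show "(\<Union>x\<in>D. cball x (r x)) \<subseteq> S" using D r by blast
    show "open {y. \<delta> < B y}" using contB[of UNIV] by (simp add: open_Collect_less continuous_on_const)
    show "K \<subseteq> {y. \<delta> < B y}" using \<delta> by blast
    show "h x = 1" if "x \<in> {y. \<delta> < B y}" for x
      using that \<delta> flat_1(2)[of "\<delta> - B x"] flat_1(2)[of "B x"] by (simp add: h_def)
    show "h x = 0" if "x \<notin> (\<Union>x\<in>D. cball x (r x))" for x
    proof -
      have "flat 1 ((r u)\<^sup>2 - (x - u)\<^sup>2) = 0" if "u \<in> D" for u
      proof -
        have "x \<notin> ball u (r u)" using \<open>x \<notin> _\<close> that by (auto simp: less_imp_le)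
        then show ?thesis using sq[OF that, of x] flat_1(2) by (simp add: not_less)
      qed
      then have "B x = 0" unfolding B_def by simp
      then show ?thesis by (simp add: h_def flat_1)
    qed
  qed
qed

section \<open>Basic neighbourhoods\<close>

text \<open>The strict inequality survives the supremum because the maximum over the compact set
  \<open>K\<close> is attained.\<close>

lemma Cp_seminorm_less_iff:
  assumes d: "Cp_on p \<Omega> d" and K: "compact K" "K \<noteq> {}" "K \<subseteq> \<Omega>" and n: "enat n \<le> p"
  shows "Cp_seminorm K n d < \<epsilon> \<longleftrightarrow> (\<forall>k\<le>n. \<forall>x\<in>K. norm (nderiv k d x) < \<epsilon>)"
proof -
  have "(SUP x\<in>K. norm (nderiv k d x)) < \<epsilon> \<longleftrightarrow> (\<forall>x\<in>K. norm (nderiv k d x) < \<epsilon>)" if "k \<le> n" for k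
  proof -
    have "enat k \<le> p" using that n by (metis enat_ord_simps(1) order.trans)
    then have "continuous_on K (\<lambda>x. norm (nderiv k d x))"
      using d K(3) continuous_on_subset unfolding Cp_on_def by (blast intro: continuous_on_norm)
    then obtain z where z: "z \<in> K" "\<And>y. y \<in> K \<Longrightarrow> norm (nderiv k d y) \<le> norm (nderiv k d z)"
      using continuous_attains_sup[OF K(1,2)] by blast
    then have "(SUP x\<in>K. norm (nderiv k d x)) = norm (nderiv k d z)"
      by (intro cSup_eq_maximum) auto
    then show ?thesis using z by fastforce
  qed
  then show ?thesis
    unfolding Cp_seminorm_def by (subst Max_less_iff) auto
qed

text \<open>A seminorm ball with maximum and supremum unfolded into pointwise bounds, and with the
  derivative of the difference split. This form lets neighbourhoods be checked by comparing
  derivatives at points.\<close>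

definition Cp_ball :: "enat \<Rightarrow> real set \<Rightarrow> real set \<Rightarrow> nat \<Rightarrow> real \<Rightarrow> (real \<Rightarrow> 'k) \<Rightarrow> (real \<Rightarrow> 'k::real_normed_vector) set" where
  "Cp_ball p \<Omega> K n \<epsilon> f =
    {g \<in> Cp_space p \<Omega>. \<forall>k\<le>n. \<forall>x\<in>K. norm (nderiv k g x - nderiv k f x) < \<epsilon>}"

lemma Cp_ball_eq_seminorm:
  assumes "open \<Omega>" "f \<in> Cp_space p \<Omega>" and K: "compact K" "K \<noteq> {}" "K \<subseteq> \<Omega>" and n: "enat n \<le> p"
  shows "Cp_ball p \<Omega> K n \<epsilon> f = {g \<in> Cp_space p \<Omega>. Cp_seminorm K n (\<lambda>x. g x - f x) < \<epsilon>}"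
proof -
  have "Cp_seminorm K n (\<lambda>x. g x - f x) < \<epsilon> \<longleftrightarrow>
      (\<forall>k\<le>n. \<forall>x\<in>K. norm (nderiv k g x - nderiv k f x) < \<epsilon>)" if g: "g \<in> Cp_space p \<Omega>" for g
  proof -
    have *: "Cp_on p \<Omega> g" "Cp_on p \<Omega> f" using assms g by (auto simp: Cp_space_def)
    have "nderiv k (\<lambda>x. g x - f x) x = nderiv k g x - nderiv k f x" if "k \<le> n" "x \<in> K" for k x
      using nderiv_diff[OF assms(1) *, of x k] that K n by (meson enat_ord_simps(1) order.trans subsetD)
    then show ?thesis
      using Cp_seminorm_less_iff[OF Cp_on_diff[OF assms(1) *] K n] by auto
  qed
  then show ?thesis unfolding Cp_ball_def by blast
qed

lemma openin_Cp_ball: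
  assumes "open \<Omega>" "f \<in> Cp_space p \<Omega>" "compact K" "K \<noteq> {}" "K \<subseteq> \<Omega>" "enat n \<le> p" "\<epsilon> > 0"
  shows "openin (Cp_topology p \<Omega>) (Cp_ball p \<Omega> K n \<epsilon> f)"
  unfolding Cp_topology_def Cp_ball_eq_seminorm[OF assms(1-6)]
  by (rule topology_generated_by_Basis) (use assms in blast)

text \<open>The generating balls form only a subbase and may be centred elsewhere. Balls centred at
  \<open>f\<close> are stable under finite intersection up to shrinking, and a generating ball that
  contains \<open>f\<close> contains a ball centred at \<open>f\<close>.\<close>

lemma openin_Cp_topology_imp_ball:
  fixes f :: "real \<Rightarrow> 'k::real_normed_vector"
  assumes \<Omega>: "open \<Omega>" and U: "openin (Cp_topology p \<Omega>) U" and "f \<in> U"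
  obtains K n \<epsilon> where "compact K" "K \<noteq> {}" "K \<subseteq> \<Omega>" "enat n \<le> p" "\<epsilon> > 0" "Cp_ball p \<Omega> K n \<epsilon> f \<subseteq> U"
proof -
  define P where "P = (\<lambda>U. \<exists>K n \<epsilon>. compact K \<and> K \<noteq> {} \<and> K \<subseteq> \<Omega> \<and> enat n \<le> p \<and> \<epsilon> > 0 \<and>
    Cp_ball p \<Omega> K n \<epsilon> f \<subseteq> (U :: (real \<Rightarrow> 'k) set))"
  have "f \<in> U \<longrightarrow> P U"
    using U unfolding Cp_topology_def openin_topology_generated_by_iff
  proof (induction rule: generate_topology_on.induct)
    case Empty
    then show ?case by simp
  next
    case (Int a b)
    show ?case
    proof
      assume "f \<in> a \<inter> b"
      then obtain K1 n1 e1 K2 n2 e2 where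
        1: "compact K1" "K1 \<noteq> {}" "K1 \<subseteq> \<Omega>" "enat n1 \<le> p" "e1 > 0" "Cp_ball p \<Omega> K1 n1 e1 f \<subseteq> a" and
        2: "compact K2" "K2 \<noteq> {}" "K2 \<subseteq> \<Omega>" "enat n2 \<le> p" "e2 > 0" "Cp_ball p \<Omega> K2 n2 e2 f \<subseteq> b"
        using Int unfolding P_def by blast
      have "Cp_ball p \<Omega> (K1 \<union> K2) (max n1 n2) (min e1 e2) f \<subseteq>
          Cp_ball p \<Omega> K1 n1 e1 f \<inter> Cp_ball p \<Omega> K2 n2 e2 f"
        unfolding Cp_ball_def by auto
      moreover have "enat (max n1 n2) \<le> p" using 1 2 by (simp add: max_def)
      ultimately show "P (a \<inter> b)"
        unfolding P_def using 1 2
        by (intro exI[of _ "K1 \<union> K2"] exI[of _ "max n1 n2"] exI[of _ "min e1 e2"]) (auto simp: compact_Un)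
    qed
  next
    case (UN k)
    then show ?case unfolding P_def by (meson Sup_upper UnionE order.trans)
  next
    case (Basis s)
    then obtain g K n \<epsilon> where s: "s = {h \<in> Cp_space p \<Omega>. Cp_seminorm K n (\<lambda>x. h x - g x) < \<epsilon>}"
      and *: "g \<in> Cp_space p \<Omega>" "compact K" "K \<noteq> {}" "K \<subseteq> \<Omega>" "enat n \<le> p" "\<epsilon> > 0" by blast
    show ?case
    proof
      assume f: "f \<in> s"
      define m where "m = Cp_seminorm K n (\<lambda>x. f x - g x)"
      have m: "m < \<epsilon>" using f unfolding s m_def by blast
      have fX: "f \<in> Cp_space p \<Omega>" using f s by blast
      have le: "norm (nderiv k f x - nderiv k g x) < e" if "k \<le> n" "x \<in> K" "m < e" for k x e
      proof -
        have "f \<in> Cp_ball p \<Omega> K n e g"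
          unfolding Cp_ball_eq_seminorm[OF \<Omega> *(1-5)] using fX that(3) by (simp add: m_def)
        then show ?thesis using that unfolding Cp_ball_def by blast
      qed
      have "Cp_ball p \<Omega> K n ((\<epsilon> - m) / 2) f \<subseteq> s"
      proof
        fix h assume h: "h \<in> Cp_ball p \<Omega> K n ((\<epsilon> - m) / 2) f"
        have "norm (nderiv k h x - nderiv k g x) < \<epsilon>" if "k \<le> n" "x \<in> K" for k x
        proof -
          have "norm (nderiv k h x - nderiv k f x) < (\<epsilon> - m) / 2"
            using h that unfolding Cp_ball_def by blast
          \<comment> \<open>The gap between \<open>m\<close> and \<open>\<epsilon>\<close> is split
            in two: one half gives the radius around \<open>f\<close>, the other makes the bound
            between \<open>f\<close> and \<open>g\<close> strictly larger than
            \<open>m\<close>.\<close>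
          moreover have "norm (nderiv k f x - nderiv k g x) < (\<epsilon> + m) / 2"
            by (rule le[OF that]) (use m in \<open>simp add: field_simps\<close>)
          moreover have "norm (nderiv k h x - nderiv k g x) \<le>
              norm (nderiv k h x - nderiv k f x) + norm (nderiv k f x - nderiv k g x)"
            by (rule norm_diff_triangle_le) auto
          ultimately show ?thesis by (simp add: field_simps)
        qed
        then show "h \<in> s"
          using h unfolding s Cp_ball_eq_seminorm[OF \<Omega> *(1-5), symmetric] by (simp add: Cp_ball_def)
      qed
      then show "P s" unfolding P_def using * m by (intro exI[of _ K] exI[of _ n] exI[of _ "(\<epsilon> - m) / 2"]) auto
    qed
  qed
  then show ?thesis using that \<open>f \<in> U\<close> unfolding P_def by blast
qed

lemma mem_Cp_ball_self: "f \<in> Cp_space p \<Omega> \<Longrightarrow> \<epsilon> > 0 \<Longrightarrow> f \<in> Cp_ball p \<Omega> K n \<epsilon> f"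
  by (simp add: Cp_ball_def)

lemma continuous_map_nderiv:
  fixes \<Omega> :: "real set"
  assumes \<Omega>: "open \<Omega>" and x: "x \<in> \<Omega>" and k: "enat k \<le> p"
  shows "continuous_map (Cp_topology p \<Omega>) euclidean (\<lambda>f. nderiv k f x :: 'k::real_normed_vector)"
proof -
  have ts: "topspace (Cp_topology p \<Omega>) = (Cp_space p \<Omega> :: (real \<Rightarrow> 'k) set)"
    using x topspace_Cp_topology by blast
  have "openin (Cp_topology p \<Omega>) {f \<in> Cp_space p \<Omega>. nderiv k f x \<in> V}" if V: "open V" for V :: "'k set"
  proof (subst openin_subopen, intro ballI)
    fix f :: "real \<Rightarrow> 'k" assume f: "f \<in> {f \<in> Cp_space p \<Omega>. nderiv k f x \<in> V}"
    then obtain e where e: "e > 0" "ball (nderiv k f x) e \<subseteq> V" using V openE by blast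
    have "Cp_ball p \<Omega> {x} k e f \<subseteq> {f \<in> Cp_space p \<Omega>. nderiv k f x \<in> V}"
      using e(2) unfolding Cp_ball_def by (auto simp: subset_iff dist_norm norm_minus_commute)
    moreover have "openin (Cp_topology p \<Omega>) (Cp_ball p \<Omega> {x} k e f)"
      by (rule openin_Cp_ball) (use f x k \<Omega> e in auto)
    ultimately show "\<exists>T. openin (Cp_topology p \<Omega>) T \<and> f \<in> T \<and> T \<subseteq> {f \<in> Cp_space p \<Omega>. nderiv k f x \<in> V}"
      using mem_Cp_ball_self[of f p \<Omega> e] f e by blast
  qed
  then show ?thesis by (simp add: continuous_map_def ts)
qed

definition extend0 :: "real set \<Rightarrow> (real \<Rightarrow> 'k::real_normed_vector) \<Rightarrow> real \<Rightarrow> 'k" where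
  "extend0 \<Omega> f = (\<lambda>x. if x \<in> \<Omega> then f x else 0)"

lemma extend0_in_Cp_space: "open \<Omega> \<Longrightarrow> Cp_on p \<Omega> f \<Longrightarrow> extend0 \<Omega> f \<in> Cp_space p \<Omega>"
  using Cp_on_cong[of \<Omega> f "extend0 \<Omega> f"] by (auto simp: Cp_space_def extend0_def)

lemma nderiv_extend0: "open \<Omega> \<Longrightarrow> x \<in> \<Omega> \<Longrightarrow> nderiv k (extend0 \<Omega> f) x = nderiv k f x"
  by (rule nderiv_cong_open[of \<Omega>]) (auto simp: extend0_def)

text \<open>The way cutoffs are exploited: equality near \<open>K\<close> forces equality of all
  derivatives on \<open>K\<close>, whatever happens elsewhere.\<close>

lemma mem_Cp_ball_cong:
  assumes "g \<in> Cp_space p \<Omega>" "open W" "K \<subseteq> W" "\<And>x. x \<in> W \<Longrightarrow> g x = f x" "\<epsilon> > 0"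
  shows "g \<in> Cp_ball p \<Omega> K n \<epsilon> f"
proof -
  have "nderiv k g x = nderiv k f x" if "x \<in> K" for k x
    by (rule nderiv_cong_open[OF assms(2)]) (use assms that in auto)
  then show ?thesis using assms by (simp add: Cp_ball_def)
qed

section \<open>A countable dense set of polynomials\<close>

definition pfun :: "'k::real_normed_field poly \<Rightarrow> real \<Rightarrow> 'k" where
  "pfun P x = poly P (of_real x)"

lemma pfun_has_vector_derivative: "(pfun P has_vector_derivative pfun (pderiv P) x) (at x)"
proof -
  have "(of_real has_vector_derivative (1::'a)) (at x)"
    using bounded_linear.has_vector_derivative[OF bounded_linear_of_real has_vector_derivative_id[of "at x"]]
    by simp
  from field_vector_diff_chain_at[OF this poly_DERIV[of P]]
  show ?thesis by (simp add: pfun_def[abs_def] o_def)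
qed

lemma nderiv_pfun: "nderiv k (pfun P) = pfun ((pderiv ^^ k) P)"
  by (induction k) (auto simp: nderiv_Suc' vector_derivative_at[OF pfun_has_vector_derivative])

lemma Cp_on_pfun: "Cp_on p UNIV (pfun P)"
  unfolding Cp_on_def nderiv_pfun
  using pfun_has_vector_derivative differentiableI_vector has_vector_derivative_continuous
  by (metis continuous_at_imp_continuous_on)

lemma pfun_diff: "pfun (P - Q) x = pfun P x - pfun Q x"
  by (simp add: pfun_def)

lemma pderiv_sum: "pderiv (\<Sum>i\<in>I. P i) = (\<Sum>i\<in>I. pderiv (P i))"
  by (induction I rule: infinite_finite_induct) (auto simp: pderiv_add)

lemma ex_pderiv_eq: "\<exists>P :: 'k::real_normed_field poly. pderiv P = Q"
proof
  show "pderiv (\<Sum>i\<le>degree Q. monom (coeff Q i / of_nat (Suc i)) (Suc i)) = Q"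
    by (subst (3) poly_as_sum_of_monoms[symmetric])
       (auto simp: pderiv_sum pderiv_monom simp del: of_nat_Suc)
qed

text \<open>A \<open>polynomial_function\<close> is polynomial in each real coordinate; with the
  basis vectors as coefficients the coordinates combine into one polynomial over the field.\<close>

lemma polynomial_function_imp_pfun:
  fixes g :: "real \<Rightarrow> 'k::{real_normed_field,euclidean_space}"
  assumes "polynomial_function g"
  obtains P where "g = pfun P"
proof -
  have "\<exists>a n. (\<lambda>x. g x \<bullet> b) = (\<lambda>x. \<Sum>i\<le>n. a i * x ^ i)" if "b \<in> Basis" for b
    using assms that real_polynomial_function_iff_sum polynomial_function_iff_Basis_inner by blast
  then obtain a n where an: "\<And>b. b \<in> Basis \<Longrightarrow> (\<lambda>x. g x \<bullet> b) = (\<lambda>x. \<Sum>i\<le>n b. a b i * x ^ i)"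
    by metis
  have "g x = pfun (\<Sum>b\<in>Basis. \<Sum>i\<le>n b. monom (a b i *\<^sub>R b) i) x" for x
  proof -
    have "g x = (\<Sum>b\<in>Basis. (\<Sum>i\<le>n b. a b i * x ^ i) *\<^sub>R b)"
      by (subst euclidean_representation[symmetric], rule sum.cong[OF refl])
         (simp add: fun_cong[OF an])
    also have "\<dots> = pfun (\<Sum>b\<in>Basis. \<Sum>i\<le>n b. monom (a b i *\<^sub>R b) i) x"
      by (simp add: pfun_def poly_sum poly_monom scaleR_conv_of_real sum_distrib_left mult_ac)
    finally show ?thesis .
  qed
  then show ?thesis using that by blast
qed

text \<open>Weierstrass approximation is applied to the highest derivative only. Each lower order is
  recovered by an antiderivative with the right value at 0, at the cost of a factor \<open>R\<close>
  in the error.\<close>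

lemma poly_approx_Cp:
  fixes f :: "real \<Rightarrow> 'k::{real_normed_field,euclidean_space}"
  assumes "Cp_on (enat n) UNIV f" "R > 0" "\<epsilon> > 0"
  shows "\<exists>P. \<forall>k\<le>n. \<forall>x\<in>{-R..R}. norm (nderiv k f x - nderiv k (pfun P) x) < \<epsilon>"
  using assms(1,3)
proof (induction n arbitrary: f \<epsilon>)
  case 0
  then have "continuous_on {-R..R} f"
    by (metis Cp_on_0 continuous_on_subset subset_UNIV)
  then obtain g where "polynomial_function g" "\<forall>x\<in>{-R..R}. norm (f x - g x) < \<epsilon>"
    using Stone_Weierstrass_polynomial_function[OF compact_Icc _ \<open>\<epsilon> > 0\<close>] by blast
  moreover obtain P where "g = pfun P" using polynomial_function_imp_pfun calculation by blast
  ultimately show ?case by (intro exI[of _ P]) simp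
next
  case (Suc n)
  note D = Cp_on_SucD[OF open_UNIV Suc.prems(1)]
  \<comment> \<open>The first bound serves the derivatives, the second the value itself; the 2 makes
    \<open>e * R < \<epsilon>\<close> strict.\<close>
  define e where "e = min \<epsilon> (\<epsilon> / (2 * R))"
  have e: "e > 0" "e \<le> \<epsilon>" "e * R < \<epsilon>"
  proof -
    show "e > 0" "e \<le> \<epsilon>" using Suc.prems assms by (auto simp: e_def)
    have "e * R \<le> \<epsilon> / (2 * R) * R" using assms by (intro mult_right_mono) (auto simp: e_def)
    also have "\<dots> < \<epsilon>" using assms Suc.prems by simp
    finally show "e * R < \<epsilon>" .
  qed
  obtain Q where Q: "\<And>k x. k \<le> n \<Longrightarrow> x \<in> {-R..R} \<Longrightarrow>
      norm (nderiv k (\<lambda>x. vector_derivative f (at x)) x - nderiv k (pfun Q) x) < e"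
    using Suc.IH[OF D(2) e(1)] by blast
  obtain P0 where P0: "pderiv P0 = Q" using ex_pderiv_eq by blast
  define P where "P = P0 + [:f 0 - pfun P0 0:]"
  have P: "pderiv P = Q" "pfun P 0 = f 0" by (auto simp: P_def P0 pderiv_add pfun_def pderiv_pCons)
  have d: "((\<lambda>x. f x - pfun P x) has_vector_derivative vector_derivative f (at x) - pfun Q x) (at x)" for x
    using has_vector_derivative_diff[OF D(1) pfun_has_vector_derivative[of P]] P by simp
  have "norm (nderiv k f x - nderiv k (pfun P) x) < \<epsilon>" if "k \<le> Suc n" and x: "x \<in> {-R..R}" for k x
  proof (cases k)
    case 0
    have "norm ((f x - pfun P x) - (f 0 - pfun P 0)) \<le> e * norm (x - 0)"
    proof (rule differentiable_bound[where S = "{-R..R}"])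
      show "((\<lambda>x. f x - pfun P x) has_derivative (\<lambda>h. h *\<^sub>R (vector_derivative f (at y) - pfun Q y)))
          (at y within {-R..R})" for y
        using has_vector_derivative_at_within[OF d] by (simp add: has_vector_derivative_def)
      show "onorm (\<lambda>h. h *\<^sub>R (vector_derivative f (at y) - pfun Q y)) \<le> e" if "y \<in> {-R..R}" for y
        by (rule onorm_le) (use Q[of 0 y] that in \<open>auto simp: mult.commute[of e] intro: mult_left_mono\<close>)
    qed (use x assms in auto)
    also have "\<dots> \<le> e * R" using x e by (intro mult_left_mono) auto
    finally show ?thesis using 0 e P by simp
  next
    case (Suc j)
    then show ?thesis
      using Q[of j x] that e by (simp add: nderiv_Suc vector_derivative_at[OF pfun_has_vector_derivative] P)
  qed
  then show ?case by blast
qed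

lemma pderiv_pow_smult: "(pderiv ^^ k) (smult c P) = smult c ((pderiv ^^ k) P)"
  by (induction k) (auto simp: pderiv_smult)

lemma pderiv_pow_sum: "(pderiv ^^ k) (\<Sum>i\<in>I. P i) = (\<Sum>i\<in>I. (pderiv ^^ k) (P i))"
  by (induction k) (auto simp: pderiv_sum)

lemma pderiv_pow_diff:
  "(pderiv ^^ k) (P - Q) = (pderiv ^^ k) P - (pderiv ^^ k) (Q :: 'k::real_normed_field poly)"
  by (induction k) (auto simp: pderiv_diff)

text \<open>Only finitely many derivatives of finitely many monomials are involved, each bounded on
  the interval by some \<open>C i\<close>; an error below \<open>\<epsilon> / (Suc N * C i)\<close>
  in each coefficient adds up to less than \<open>\<epsilon>\<close>.\<close>

lemma perturb_coeffs:
  fixes D :: "'k::real_normed_field set"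
  assumes D: "\<And>z e. e > 0 \<Longrightarrow> \<exists>d\<in>D. norm (z - d) < e" and "\<epsilon> > 0"
  shows "\<exists>c. (\<forall>i. c i \<in> D) \<and> (\<forall>k\<le>n. \<forall>x\<in>{-R..R}.
    norm (pfun ((pderiv ^^ k) P) x - pfun ((pderiv ^^ k) (\<Sum>i\<le>degree P. monom (c i) i)) x) < \<epsilon>)"
proof -
  define N where "N = degree P"
  have "\<exists>C>0. \<forall>k\<le>n. \<forall>x\<in>{-R..R}. norm (pfun ((pderiv ^^ k) (monom (1::'k) i)) x) \<le> C" for i
  proof -
    have "compact (\<Union>k\<le>n. (\<lambda>x. pfun ((pderiv ^^ k) (monom (1::'k) i)) x) ` {-R..R})"
      using Cp_on_continuous[OF Cp_on_pfun] continuous_on_subset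
      by (intro compact_UN compact_continuous_image) (auto intro: continuous_on_subset)
    then obtain C where "C > 0" "\<forall>z\<in>(\<Union>k\<le>n. (\<lambda>x. pfun ((pderiv ^^ k) (monom (1::'k) i)) x) ` {-R..R}). norm z \<le> C"
      using compact_imp_bounded bounded_pos by metis
    then show ?thesis by blast
  qed
  then obtain C where C: "\<And>i. C i > 0"
    "\<And>i k x. k \<le> n \<Longrightarrow> x \<in> {-R..R} \<Longrightarrow> norm (pfun ((pderiv ^^ k) (monom (1::'k) i)) x) \<le> C i" by metis
  have "\<exists>d\<in>D. norm (coeff P i - d) < \<epsilon> / (Suc N * C i)" for i
    by (rule D) (use C assms in \<open>simp\<close>)
  then obtain c where c: "\<And>i. c i \<in> D" "\<And>i. norm (coeff P i - c i) < \<epsilon> / (Suc N * C i)" by metis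
  have "norm (pfun ((pderiv ^^ k) P) x - pfun ((pderiv ^^ k) (\<Sum>i\<le>N. monom (c i) i)) x) < \<epsilon>"
    if "k \<le> n" "x \<in> {-R..R}" for k x
  proof -
    have "P - (\<Sum>i\<le>N. monom (c i) i) = (\<Sum>i\<le>N. smult (coeff P i - c i) (monom 1 i))"
      unfolding N_def
      by (subst (1) poly_as_sum_of_monoms[symmetric])
         (simp add: sum_subtractf[symmetric] diff_monom smult_monom)
    then have "pfun ((pderiv ^^ k) P) x - pfun ((pderiv ^^ k) (\<Sum>i\<le>N. monom (c i) i)) x =
        (\<Sum>i\<le>N. (coeff P i - c i) * pfun ((pderiv ^^ k) (monom 1 i)) x)"
      by (simp only: pfun_diff[symmetric] pderiv_pow_diff[symmetric])
         (simp add: pderiv_pow_sum pderiv_pow_smult pfun_def poly_sum)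
    also have "norm \<dots> \<le> (\<Sum>i\<le>N. norm (coeff P i - c i) * C i)"
      using C that by (intro order.trans[OF norm_sum] sum_mono) (auto simp: norm_mult intro: mult_left_mono)
    also have "\<dots> < (\<Sum>i\<le>N. \<epsilon> / Suc N)"
    proof (rule sum_strict_mono)
      fix i
      have "norm (coeff P i - c i) * C i < \<epsilon> / (Suc N * C i) * C i"
        by (rule mult_strict_right_mono) (use c C in auto)
      then show "norm (coeff P i - c i) * C i < \<epsilon> / Suc N"
        using C(1)[of i] by simp
    qed auto
    also have "\<dots> = \<epsilon>" by simp
    finally show ?thesis .
  qed
  then show ?thesis using c N_def by blast
qed

text \<open>The coefficients are taken from a countable dense set of scalars, so that one sequence
  serves all orders, intervals and tolerances simultaneously.\<close>

lemma countable_dense_polys: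
  obtains q :: "nat \<Rightarrow> 'k::{real_normed_field,euclidean_space} poly" where
    "\<And>n f R \<epsilon>. Cp_on (enat n) UNIV f \<Longrightarrow> R > 0 \<Longrightarrow> \<epsilon> > 0 \<Longrightarrow>
      \<exists>i. \<forall>k\<le>n. \<forall>x\<in>{-R..R}. norm (nderiv k f x - nderiv k (pfun (q i)) x) < \<epsilon>"
proof -
  obtain D :: "'k set" where cD: "countable D" and D: "\<And>U. open U \<Longrightarrow> U \<noteq> {} \<Longrightarrow> \<exists>d\<in>D. d \<in> U"
    using countable_dense_setE by blast
  have D: "\<exists>d\<in>D. norm (z - d) < e" if "e > 0" for z e
    using D[of "ball z e"] that by (auto simp: dist_norm)
  define S where "S = (\<lambda>cs. \<Sum>i<length cs. monom (cs ! i) i) ` lists D"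
  have "countable S" unfolding S_def using cD by (intro countable_image countable_lists)
  moreover have "S \<noteq> {}" unfolding S_def by auto
  ultimately obtain q :: "nat \<Rightarrow> 'k poly" where q: "range q = S"
    using range_from_nat_into by metis
  show ?thesis
  proof (rule that[of q])
    fix n f and R \<epsilon> :: real assume *: "Cp_on (enat n) UNIV (f :: real \<Rightarrow> 'k)" "R > 0" "\<epsilon> > 0"
    obtain P where P: "\<And>k x. k\<le>n \<Longrightarrow> x\<in>{-R..R} \<Longrightarrow> norm (nderiv k f x - nderiv k (pfun P) x) < \<epsilon>/2"
      using poly_approx_Cp[OF *(1,2), of "\<epsilon>/2"] half_gt_zero[OF *(3)] by blast
    obtain c where c: "\<And>i. c i \<in> D" "\<And>k x. k\<le>n \<Longrightarrow> x\<in>{-R..R} \<Longrightarrow>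
        norm (pfun ((pderiv ^^ k) P) x - pfun ((pderiv ^^ k) (\<Sum>i\<le>degree P. monom (c i) i)) x) < \<epsilon>/2"
      using perturb_coeffs[OF D, of "\<epsilon>/2" n R P] half_gt_zero[OF *(3)] by blast
    have "(\<Sum>i\<le>degree P. monom (c i) i) \<in> S"
      unfolding S_def
      by (rule image_eqI[of _ _ "map c [0..<Suc (degree P)]"])
         (use c in \<open>auto simp: lessThan_Suc_atMost simp del: upt_Suc intro!: sum.cong\<close>)
    then obtain i where i: "q i = (\<Sum>i\<le>degree P. monom (c i) i)" using q by (metis imageE)
    have "norm (nderiv k f x - nderiv k (pfun (q i)) x) < \<epsilon>" if "k \<le> n" "x \<in> {-R..R}" for k x
      using norm_diff_triangle_less[OF P[OF that] c(2)[OF that, folded nderiv_pfun]] i by simp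
    then show "\<exists>i. \<forall>k\<le>n. \<forall>x\<in>{-R..R}. norm (nderiv k f x - nderiv k (pfun (q i)) x) < \<epsilon>" by blast
  qed
qed

section \<open>Orbits of fixed point free maps\<close>

lemma funpow_in: "\<psi> ` \<Omega> \<subseteq> \<Omega> \<Longrightarrow> x \<in> \<Omega> \<Longrightarrow> (\<psi> ^^ n) x \<in> \<Omega>"
  by (induction n) auto

lemma continuous_on_funpow:
  fixes \<psi> :: "'a::topological_space \<Rightarrow> 'a"
  assumes "continuous_on \<Omega> \<psi>" "\<psi> ` \<Omega> \<subseteq> \<Omega>"
  shows "continuous_on \<Omega> (\<psi> ^^ n)"
proof (induction n)
  case (Suc n)
  have "continuous_on \<Omega> (\<lambda>x. \<psi> ((\<psi> ^^ n) x))"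
    by (rule continuous_on_compose2[OF assms(1) Suc]) (use funpow_in[OF assms(2)] in auto)
  then show ?case by simp
qed simp

text \<open>On a connected set f(x) - x has a constant sign \<open>s\<close>, so orbits are
  monotone. On the compact interval each step has length at least some \<open>\<delta> > 0\<close>,
  which leaves room for only (\<open>\<beta>\<close> - \<open>\<alpha>\<close>) /
  \<open>\<delta>\<close> steps.\<close>

lemma fixpoint_free_orbit_leaves:
  fixes f :: "real \<Rightarrow> real"
  assumes C: "connected C" and f: "continuous_on C f" "f ` C \<subseteq> C" and nofix: "\<And>x. x \<in> C \<Longrightarrow> f x \<noteq> x"
    and J: "{\<alpha>..\<beta>} \<subseteq> C" "\<alpha> \<le> \<beta>"
  shows "\<exists>Q. \<forall>q\<ge>Q. \<forall>z\<in>{\<alpha>..\<beta>}. (f ^^ q) z \<notin> {\<alpha>..\<beta>}"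
proof -
  have con: "connected ((\<lambda>x. f x - x) ` C)"
    using C f(1) by (intro connected_continuous_image continuous_intros)
  have "0 \<notin> (\<lambda>x. f x - x) ` C" using nofix by force
  then have ns: "\<not> (\<exists>x\<in>C. \<exists>y\<in>C. f x - x < 0 \<and> f y - y > 0)"
    using connected_contains_Icc[OF con] by (force simp: subset_iff)
  then obtain s :: real where s: "\<bar>s\<bar> = 1" "\<And>x. x \<in> C \<Longrightarrow> s * (f x - x) > 0"
  proof (cases "\<exists>x\<in>C. f x - x < 0")
    case True
    show ?thesis
      by (rule that[of "-1"]) (use True ns nofix in \<open>force simp: not_less\<close>)+
  next
    case False
    show ?thesis
      by (rule that[of 1]) (use False nofix in \<open>force simp: not_less\<close>)+
  qed
  have "continuous_on {\<alpha>..\<beta>} (\<lambda>x. s * (f x - x))"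
    using continuous_on_subset[OF f(1) J(1)] by (intro continuous_intros)
  then obtain w where w: "w \<in> {\<alpha>..\<beta>}" "\<And>x. x \<in> {\<alpha>..\<beta>} \<Longrightarrow> s * (f w - w) \<le> s * (f x - x)"
    using continuous_attains_inf[of "{\<alpha>..\<beta>}" "\<lambda>x. s * (f x - x)"] J by auto
  define \<delta> where "\<delta> = s * (f w - w)"
  have \<delta>: "\<delta> > 0" using s w J by (auto simp: \<delta>_def)
  have inC: "(f ^^ q) z \<in> C" if "z \<in> {\<alpha>..\<beta>}" for q z using funpow_in[OF f(2)] that J by blast
  have mono: "s * z \<le> s * (f ^^ q) z" if "z \<in> {\<alpha>..\<beta>}" for q z
  proof (induction q)
    case (Suc q)
    then show ?case using s(2)[OF inC[OF that, of q]] by (simp add: algebra_simps)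
  qed simp
  \<comment> \<open>By monotonicity a point that is in the interval at time \<open>q\<close> was
    there at all earlier times, so each of the \<open>q\<close> steps counts with at least
    \<open>\<delta>\<close>.\<close>
  have step: "s * ((f ^^ q) z - z) \<ge> q * \<delta>" if z: "z \<in> {\<alpha>..\<beta>}" and "(f ^^ q) z \<in> {\<alpha>..\<beta>}" for q z
    using that(2)
  proof (induction q)
    case (Suc q)
    let ?y = "(f ^^ q) z"
    have "s * z \<le> s * ?y" "s * ?y < s * f ?y"
      using mono[OF z] s(2)[OF inC[OF z, of q]] by (auto simp: algebra_simps)
    moreover have "s = 1 \<or> s = -1" using s(1) by linarith
    ultimately have "?y \<in> {\<alpha>..\<beta>}" using z Suc.prems by auto
    then have "s * (f ?y - ?y) \<ge> \<delta>" "s * (?y - z) \<ge> q * \<delta>" using w Suc.IH by (auto simp: \<delta>_def)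
    then show ?case by (simp add: algebra_simps)
  qed simp
  obtain Q :: nat where Q: "(\<beta> - \<alpha>) / \<delta> < Q" using reals_Archimedean2 by blast
  have "(f ^^ q) z \<notin> {\<alpha>..\<beta>}" if "q \<ge> Q" "z \<in> {\<alpha>..\<beta>}" for q z
  proof
    assume a: "(f ^^ q) z \<in> {\<alpha>..\<beta>}"
    have "\<beta> - \<alpha> < Q * \<delta>" using Q \<delta> by (simp add: field_simps)
    also have "\<dots> \<le> q * \<delta>" using that \<delta> by simp
    also have "\<dots> \<le> s * ((f ^^ q) z - z)" using step[OF that(2) a] .
    also have "\<dots> \<le> \<bar>s * ((f ^^ q) z - z)\<bar>" by simp
    also have "\<dots> \<le> \<beta> - \<alpha>" using a that(2) s(1) by (auto simp: abs_mult abs_le_iff)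
    finally show False by simp
  qed
  then show ?thesis by blast
qed

text \<open>If \<open>K\<close> kept returning, start and end points of the returns would accumulate
  at some \<open>x\<close> and \<open>y\<close>. The component of \<open>x\<close> is then sent into
  that of \<open>y\<close> at infinitely many times, and the difference \<open>m\<close> of two such
  times gives an iterate \<open>f\<close> that maps the component of \<open>y\<close> into itself.
  This \<open>f\<close> has no fixed point, so its orbits leave every compact interval, while the
  later returns say the opposite.\<close>

lemma compact_escapes:
  fixes \<psi> :: "real \<Rightarrow> real"
  assumes \<Omega>: "open \<Omega>" and \<psi>: "continuous_on \<Omega> \<psi>" "\<psi> ` \<Omega> \<subseteq> \<Omega>"
    and noper: "\<And>x n. x \<in> \<Omega> \<Longrightarrow> n \<ge> 1 \<Longrightarrow> (\<psi> ^^ n) x \<noteq> x"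
    and K: "compact K" "K \<subseteq> \<Omega>"
  shows "\<exists>N. \<forall>n\<ge>N. (\<psi> ^^ n) ` K \<inter> K = {}"
proof (rule ccontr)
  assume "\<not> ?thesis"
  then have "\<forall>N. \<exists>n x. n \<ge> N \<and> x \<in> K \<and> (\<psi> ^^ n) x \<in> K" by blast
  then obtain n a where n: "\<And>k. n k \<ge> k" and a: "\<And>k::nat. a k \<in> K" "\<And>k. (\<psi> ^^ n k) (a k) \<in> K" by metis
  define F where "F = (\<lambda>k. (a k, (\<psi> ^^ n k) (a k)))"
  have "compact (K \<times> K)" using K compact_Times by blast
  moreover have "\<forall>k. F k \<in> K \<times> K" using a by (simp add: F_def)
  ultimately obtain l r where l: "l \<in> K \<times> K" and r: "strict_mono (r :: nat \<Rightarrow> nat)"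
    and lim: "(F \<circ> r) \<longlonglongrightarrow> l"
    using compact_def[THEN iffD1, rule_format, of "K \<times> K" F] by blast
  obtain x y where xy: "l = (x, y)" "x \<in> \<Omega>" "y \<in> \<Omega>" using l K by (cases l) auto
  have limx: "(\<lambda>k. a (r k)) \<longlonglongrightarrow> x" and limy: "(\<lambda>k. (\<psi> ^^ n (r k)) (a (r k))) \<longlonglongrightarrow> y"
    using tendsto_fst[OF lim] tendsto_snd[OF lim] by (auto simp: xy o_def F_def)
  define cc where "cc = connected_component_set \<Omega>"
  have cc_ball: "\<exists>e>0. cball z e \<subseteq> cc z" if z: "z \<in> \<Omega>" for z
  proof -
    obtain e where e: "e > 0" "cball z e \<subseteq> \<Omega>" using \<Omega> z open_contains_cball by blast
    then have "cball z e \<subseteq> cc z"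
      unfolding cc_def by (intro connected_component_maximal) auto
    then show ?thesis using e by blast
  qed
  obtain e e' where e: "e > 0" "cball x e \<subseteq> cc x" "e' > 0" "cball y e' \<subseteq> cc y"
    using cc_ball xy by meson
  have ccsub: "cc z \<subseteq> \<Omega>" for z unfolding cc_def by (rule connected_component_subset)
  \<comment> \<open>One point decides where a whole component goes, since its image is connected and
    stays in \<open>\<Omega>\<close>.\<close>
  have map: "(\<psi> ^^ m) ` cc u \<subseteq> cc v" if "w \<in> cc u" "(\<psi> ^^ m) w \<in> cc v" for m u v w
  proof -
    have "connected ((\<psi> ^^ m) ` cc u)"
      using continuous_on_subset[OF continuous_on_funpow[OF \<psi>] ccsub]
      by (intro connected_continuous_image) (auto simp: cc_def)
    moreover have "(\<psi> ^^ m) ` cc u \<subseteq> \<Omega>" using ccsub funpow_in[OF \<psi>(2)] by blast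
    ultimately have "(\<psi> ^^ m) ` cc u \<subseteq> connected_component_set \<Omega> ((\<psi> ^^ m) w)"
      using that(1) by (intro connected_component_maximal) auto
    moreover have "connected_component_set \<Omega> ((\<psi> ^^ m) w) = cc v"
      using that(2) unfolding cc_def by (metis connected_component_eq)
    ultimately show ?thesis by blast
  qed
  define A where "A = {m. \<exists>z\<in>cball x e. (\<psi> ^^ m) z \<in> cball y e'}"
  have A: "(\<psi> ^^ m) ` cc x \<subseteq> cc y" if "m \<in> A" for m
    using that map[of _ x m y] e unfolding A_def by blast
  have infA: "infinite A"
    unfolding infinite_nat_iff_unbounded_le
  proof
    fix m
    have "\<forall>\<^sub>F k in sequentially. a (r k) \<in> ball x e \<and> (\<psi> ^^ n (r k)) (a (r k)) \<in> ball y e' \<and> k \<ge> m"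
      using topological_tendstoD[OF limx, of "ball x e"] topological_tendstoD[OF limy, of "ball y e'"] e
      by (auto simp: eventually_conj_iff eventually_ge_at_top)
    then obtain k where k: "a (r k) \<in> ball x e" "(\<psi> ^^ n (r k)) (a (r k)) \<in> ball y e'" "k \<ge> m"
      using eventually_happens'[OF sequentially_bot] by blast
    then have "n (r k) \<in> A" unfolding A_def using ball_subset_cball by blast
    moreover have "m \<le> n (r k)" using n[of "r k"] seq_suble[OF r, of k] k(3) by linarith
    ultimately show "\<exists>j\<ge>m. j \<in> A" by blast
  qed
  obtain n1 where n1: "n1 \<in> A" using infA by (metis finite.emptyI ex_in_conv)
  obtain n2 where n2: "n2 \<in> A" "n2 > n1" using infA infinite_nat_iff_unbounded by blast
  define m where "m = n2 - n1"
  have m: "m \<ge> 1" using n2 m_def by simp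
  define f where "f = \<psi> ^^ m"
  have xcc: "x \<in> cc x" using e(1,2) by force
  have f_cc: "f ` cc y \<subseteq> cc y"
  proof -
    have "(\<psi> ^^ n1) x \<in> cc y" using A[OF n1] xcc by blast
    moreover have "f ((\<psi> ^^ n1) x) = (\<psi> ^^ n2) x"
      unfolding f_def m_def using n2 by (metis comp_apply funpow_add le_add_diff_inverse2 less_imp_le)
    moreover have "(\<psi> ^^ n2) x \<in> cc y" using A[OF n2(1)] xcc by blast
    ultimately show ?thesis unfolding f_def using map by metis
  qed
  \<comment> \<open>Return times in one residue class modulo \<open>m\<close> differ by multiples of
    \<open>m\<close>, so each later one is \<open>n0\<close> steps followed by iterates of
    \<open>f\<close>.\<close>
  have "finite ((\<lambda>j. j mod m) ` A)"
    by (rule finite_subset[of _ "{..<m}"]) (use m in auto)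
  then obtain n0 where n0: "n0 \<in> A" "infinite {j \<in> A. j mod m = n0 mod m}"
    using pigeonhole_infinite[OF infA] by blast
  \<comment> \<open>Contains the points from which \<open>f\<close> starts after \<open>n0\<close>
    steps as well as the points at which the returns end; its hull is an interval in the component
    of \<open>y\<close>.\<close>
  define M where "M = (\<psi> ^^ n0) ` cball x e \<union> cball y e'"
  have "cball x e \<subseteq> \<Omega>" using e ccsub by blast
  then have cM: "compact M" unfolding M_def
    using continuous_on_subset[OF continuous_on_funpow[OF \<psi>]]
    by (intro compact_Un compact_continuous_image) auto
  have Mcc: "M \<subseteq> cc y" using A[OF n0(1)] e unfolding M_def by blast
  have "M \<noteq> {}" using e unfolding M_def by auto
  then obtain \<alpha> \<beta> where \<alpha>: "\<alpha> \<in> M" "\<And>z. z \<in> M \<Longrightarrow> \<alpha> \<le> z" and \<beta>: "\<beta> \<in> M" "\<And>z. z \<in> M \<Longrightarrow> z \<le> \<beta>"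
    using compact_attains_inf[OF cM] compact_attains_sup[OF cM] by metis
  have ccy: "connected (cc y)" by (simp add: cc_def)
  have J: "{\<alpha>..\<beta>} \<subseteq> cc y" using connected_contains_Icc[OF ccy] \<alpha> \<beta> Mcc by blast
  have "continuous_on (cc y) f" unfolding f_def
    using continuous_on_subset[OF continuous_on_funpow[OF \<psi>] ccsub] .
  then obtain Q where Q: "\<And>q z. q \<ge> Q \<Longrightarrow> z \<in> {\<alpha>..\<beta>} \<Longrightarrow> (f ^^ q) z \<notin> {\<alpha>..\<beta>}"
    using fixpoint_free_orbit_leaves[OF ccy _ f_cc _ J] noper m ccsub \<alpha> \<beta> unfolding f_def by blast
  obtain j where j: "j \<in> A" "j mod m = n0 mod m" "j \<ge> n0 + m * Q"
    using n0(2) unfolding infinite_nat_iff_unbounded_le by blast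
  then have "m dvd j - n0" using mod_eq_dvd_iff_nat[of n0 j m] by simp
  then obtain q where q: "j - n0 = m * q" by blast
  have "q \<ge> Q" using q j(3) m by (metis add_le_imp_le_diff le_add_diff_inverse mult_le_cancel1 not_one_le_zero gr0I add.commute)
  obtain z where z: "z \<in> cball x e" "(\<psi> ^^ j) z \<in> cball y e'" using j(1) A_def by blast
  have "(f ^^ q) ((\<psi> ^^ n0) z) = (\<psi> ^^ j) z"
  proof -
    have "j = m * q + n0" using q j(3) by simp
    then show ?thesis unfolding f_def by (simp add: funpow_mult funpow_add)
  qed
  moreover have "(\<psi> ^^ n0) z \<in> M" "(\<psi> ^^ j) z \<in> M" using z unfolding M_def by auto
  ultimately show False using Q[OF \<open>q \<ge> Q\<close>, of "(\<psi> ^^ n0) z"] \<alpha> \<beta> by auto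
qed

text \<open>The sum is junk (\<open>0\<close>) at points where infinitely many terms are nonzero.\<close>

definition locally_finite_sum :: "('i \<Rightarrow> real \<Rightarrow> 'k::real_normed_vector) \<Rightarrow> real \<Rightarrow> 'k" where
  "locally_finite_sum E x = (\<Sum>i\<in>{i. E i x \<noteq> 0}. E i x)"

lemma locally_finite_sum_in_Cp_space:
  assumes \<Omega>: "open \<Omega>" and E: "\<And>i. E i \<in> Cp_space p \<Omega>"
    and fin: "\<And>M. compact M \<Longrightarrow> M \<subseteq> \<Omega> \<Longrightarrow> finite {i. \<exists>y\<in>M. E i y \<noteq> 0}"
  shows "locally_finite_sum E \<in> Cp_space p \<Omega>"
proof -
  have "Cp_on p \<Omega> (locally_finite_sum E)"
  proof (rule Cp_on_local[OF \<Omega>])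
    fix x assume x: "x \<in> \<Omega>"
    obtain e where e: "e > 0" "cball x e \<subseteq> \<Omega>" using \<Omega> x open_contains_cball by blast
    define I where "I = {i. \<exists>y\<in>cball x e. E i y \<noteq> 0}"
    have I: "finite I" unfolding I_def using fin e by simp
    have sub: "ball x e \<subseteq> \<Omega>" using e ball_subset_cball by blast
    have "Cp_on p (ball x e) (\<lambda>y. \<Sum>i\<in>I. E i y)"
      by (rule Cp_on_sum) (use E Cp_on_mono[OF _ order_refl sub] in \<open>auto simp: Cp_space_def\<close>)
    moreover have "locally_finite_sum E y = (\<Sum>i\<in>I. E i y)" if "y \<in> ball x e" for y
      unfolding locally_finite_sum_def
      by (rule sum.mono_neutral_left[OF I]) (use that in \<open>auto simp: I_def intro: less_imp_le\<close>)
    ultimately show "\<exists>U g. open U \<and> x \<in> U \<and> Cp_on p U g \<and> (\<forall>y\<in>U. locally_finite_sum E y = g y)"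
      using e by (intro exI[of _ "ball x e"] exI[of _ "\<lambda>y. \<Sum>i\<in>I. E i y"]) auto
  qed
  then show ?thesis using E by (auto simp: Cp_space_def locally_finite_sum_def)
qed

lemma locally_finite_sum_single:
  assumes "\<And>j. j \<noteq> i \<Longrightarrow> E j x = 0"
  shows "locally_finite_sum E x = E i x"
proof -
  have "{j. E j x \<noteq> 0} = (if E i x = 0 then {} else {i})" using assms by (auto; metis)
  then show ?thesis by (simp add: locally_finite_sum_def)
qed

section \<open>Weighted composition operators\<close>

locale weighted_composition =
  fixes \<Omega> :: "real set" and p :: enat and \<psi> :: "real \<Rightarrow> real"
    and \<omega> :: "real \<Rightarrow> 'k::{real_normed_field,euclidean_space}"
  assumes open_\<Omega>: "open \<Omega>" and \<Omega>_nonempty: "\<Omega> \<noteq> {}" and p_ge_1: "p \<ge> 1"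
    and Cp_\<psi>: "Cp_on p \<Omega> \<psi>" and \<psi>_\<Omega>: "\<psi> ` \<Omega> \<subseteq> \<Omega>" and Cp_\<omega>: "Cp_on p \<Omega> \<omega>"
begin

abbreviation "T \<equiv> weighted_comp \<Omega> \<omega> \<psi>"
abbreviation "X \<equiv> (Cp_topology p \<Omega> :: (real \<Rightarrow> 'k) topology)"

text \<open>The cocycle over \<open>\<psi>\<close> generated by the weight: on
  \<open>\<Omega>\<close>, the \<open>n\<close>-th iterate of the operator is composition with
  \<open>\<psi> ^^ n\<close> followed by multiplication with \<open>W n\<close>.\<close>

definition W :: "nat \<Rightarrow> real \<Rightarrow> 'k" where
  "W n x = (\<Prod>i<n. \<omega> ((\<psi> ^^ i) x))"

lemma topspace_X: "topspace X = Cp_space p \<Omega>"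
  using topspace_Cp_topology[OF \<Omega>_nonempty] .

lemmas \<psi>_funpow_in = funpow_in[OF \<psi>_\<Omega>]

lemma Cp_on_\<psi>_funpow: "Cp_on p \<Omega> (\<psi> ^^ n)"
proof (induction n)
  case 0
  then show ?case using Cp_on_ident[OF open_\<Omega>] by (simp add: id_def)
next
  case (Suc n)
  have "Cp_on p \<Omega> (\<lambda>x. \<psi> ((\<psi> ^^ n) x))"
    by (rule Cp_on_compose[OF open_\<Omega> open_\<Omega> _ Cp_\<psi> Suc]) (use \<psi>_funpow_in in auto)
  then show ?case by (simp add: o_def)
qed

lemma Cp_on_compose_\<psi>_funpow: "Cp_on p \<Omega> f \<Longrightarrow> Cp_on p \<Omega> (\<lambda>x. f ((\<psi> ^^ n) x))"
  by (rule Cp_on_compose[OF open_\<Omega> open_\<Omega> _ _ Cp_on_\<psi>_funpow]) (use \<psi>_funpow_in in auto)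

lemma Cp_on_W: "Cp_on p \<Omega> (W n)"
proof -
  have "Cp_on p \<Omega> (\<lambda>x. \<Prod>i<n. \<omega> ((\<psi> ^^ i) x))"
    by (rule Cp_on_prod_set[OF open_\<Omega>]) (rule Cp_on_compose_\<psi>_funpow[OF Cp_\<omega>])
  then show ?thesis by (simp add: W_def[abs_def])
qed

lemma W_Suc: "W (Suc n) x = \<omega> x * W n (\<psi> x)"
  unfolding W_def by (subst prod.lessThan_Suc_shift) (simp add: funpow_swap1)

lemma W_add: "W (m + n) x = W m x * W n ((\<psi> ^^ m) x)"
  by (induction m arbitrary: x) (auto simp: W_Suc funpow_swap1 W_def[of 0])

lemma T_funpow_apply:
  assumes "f \<in> Cp_space p \<Omega>"
  shows "(T ^^ n) f x = (if x \<in> \<Omega> then W n x * f ((\<psi> ^^ n) x) else 0)"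
proof (induction n arbitrary: x)
  case 0
  then show ?case using assms by (simp add: W_def Cp_space_def)
next
  case (Suc n)
  have "(T ^^ Suc n) f x = T ((T ^^ n) f) x" by simp
  also have "\<dots> = (if x \<in> \<Omega> then \<omega> x * (T ^^ n) f (\<psi> x) else 0)" by (simp add: weighted_comp_def)
  also have "\<dots> = (if x \<in> \<Omega> then W (Suc n) x * f ((\<psi> ^^ Suc n) x) else 0)"
    using Suc \<psi>_\<Omega> by (auto simp: W_Suc funpow_swap1)
  finally show ?case .
qed

lemma T_funpow_in:
  assumes "f \<in> Cp_space p \<Omega>"
  shows "(T ^^ n) f \<in> Cp_space p \<Omega>"
proof -
  have "extend0 \<Omega> (\<lambda>x. W n x * f ((\<psi> ^^ n) x)) \<in> Cp_space p \<Omega>"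
    by (rule extend0_in_Cp_space[OF open_\<Omega> Cp_on_mult[OF open_\<Omega> Cp_on_W Cp_on_compose_\<psi>_funpow]])
       (use assms in \<open>simp add: Cp_space_def\<close>)
  moreover have "extend0 \<Omega> (\<lambda>x. W n x * f ((\<psi> ^^ n) x)) = (T ^^ n) f"
    using T_funpow_apply[OF assms] by (auto simp: extend0_def)
  ultimately show ?thesis by simp
qed

lemma cutoff_mult_in:
  assumes "\<And>p. Cp_on p UNIV c" "f \<in> Cp_space p \<Omega>"
  shows "(\<lambda>x. c x *\<^sub>R f x) \<in> Cp_space p \<Omega>"
  using Cp_on_scaleR[OF open_\<Omega> Cp_on_mono[OF assms(1) order_refl subset_UNIV]] assms(2)
  by (auto simp: Cp_space_def)

lemma openin_X_obtain:
  assumes "openin X U" "U \<noteq> {}"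
  obtains f K n \<epsilon> where "f \<in> U" "f \<in> Cp_space p \<Omega>" "compact K" "K \<noteq> {}" "K \<subseteq> \<Omega>" "enat n \<le> p" "\<epsilon> > 0"
    "Cp_ball p \<Omega> K n \<epsilon> f \<subseteq> U"
proof -
  obtain f where f: "f \<in> U" using assms by blast
  then have "f \<in> Cp_space p \<Omega>" using openin_subset[OF assms(1)] topspace_X by blast
  then show ?thesis
    using openin_Cp_topology_imp_ball[OF open_\<Omega> assms(1) f] that f by metis
qed

end

section \<open>Sufficient conditions\<close>

locale runaway_weighted_composition = weighted_composition +
  assumes \<omega>_nz: "\<And>x. x \<in> \<Omega> \<Longrightarrow> \<omega> x \<noteq> 0" and \<psi>_inj: "inj_on \<psi> \<Omega>"
    and \<psi>_deriv_nz: "\<And>x. x \<in> \<Omega> \<Longrightarrow> vector_derivative \<psi> (at x) \<noteq> 0"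
    and \<psi>_no_periodic: "\<And>x n. x \<in> \<Omega> \<Longrightarrow> n \<ge> 1 \<Longrightarrow> (\<psi> ^^ n) x \<noteq> x"
begin

lemma W_nz: "x \<in> \<Omega> \<Longrightarrow> W n x \<noteq> 0"
  unfolding W_def using \<omega>_nz \<psi>_funpow_in by auto

lemma \<psi>_funpow_inj: "inj_on (\<psi> ^^ n) \<Omega>"
proof (induction n)
  case (Suc n)
  have "(\<psi> ^^ n) ` \<Omega> \<subseteq> \<Omega>" using \<psi>_funpow_in by auto
  then show ?case using comp_inj_on[OF Suc, of \<psi>] \<psi>_inj inj_on_subset by (metis funpow.simps(2))
qed simp

lemma \<psi>_funpow_deriv_nz: "x \<in> \<Omega> \<Longrightarrow> vector_derivative (\<psi> ^^ n) (at x) \<noteq> 0"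
proof (induction n)
  case 0
  show ?case by (simp add: id_def)
next
  case (Suc n)
  have d: "((\<psi> ^^ n) has_vector_derivative vector_derivative (\<psi> ^^ n) (at x)) (at x)"
    by (rule Cp_on_has_vector_derivative[OF Cp_on_\<psi>_funpow Suc.prems p_ge_1])
  have in\<Omega>: "(\<psi> ^^ n) x \<in> \<Omega>" using Suc.prems \<psi>_funpow_in by blast
  have "(\<psi> \<circ> (\<psi> ^^ n) has_vector_derivative
      vector_derivative (\<psi> ^^ n) (at x) *\<^sub>R vector_derivative \<psi> (at ((\<psi> ^^ n) x))) (at x)"
    by (rule vector_diff_chain_at[OF d Cp_on_has_vector_derivative[OF Cp_\<psi> in\<Omega> p_ge_1]])
  then show ?case using Suc \<psi>_deriv_nz[OF in\<Omega>] by (simp add: vector_derivative_at del: o_apply)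
qed

lemma escapes:
  assumes "compact K" "K \<subseteq> \<Omega>" "compact M" "M \<subseteq> \<Omega>"
  shows "\<exists>N. \<forall>n\<ge>N. (\<psi> ^^ n) ` K \<inter> M = {}"
proof -
  have "compact (K \<union> M)" "K \<union> M \<subseteq> \<Omega>" using assms by (auto simp: compact_Un)
  then have "\<exists>N. \<forall>n\<ge>N. (\<psi> ^^ n) ` (K \<union> M) \<inter> (K \<union> M) = {}"
    by (intro compact_escapes[OF open_\<Omega> Cp_on_continuous[OF Cp_\<psi>] \<psi>_\<Omega> \<psi>_no_periodic]) auto
  then show ?thesis by blast
qed

text \<open>A right inverse of \<open>T ^^ n\<close> on functions whose support is compact in \<open>\<Omega>\<close>; without the
  support condition \<^term>\<open>push n u\<close> need not be smooth at the boundary of the range of \<open>\<psi> ^^ n\<close>.\<close>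

definition push :: "nat \<Rightarrow> (real \<Rightarrow> 'a) \<Rightarrow> real \<Rightarrow> 'a" where
  "push n u y = (if y \<in> (\<psi> ^^ n) ` \<Omega>
     then u (inv_into \<Omega> (\<psi> ^^ n) y) / W n (inv_into \<Omega> (\<psi> ^^ n) y) else 0)"

lemma push_apply: "x \<in> \<Omega> \<Longrightarrow> push n u ((\<psi> ^^ n) x) = u x / W n x"
  by (simp add: push_def inv_into_f_f[OF \<psi>_funpow_inj])

lemma push_0: "u \<in> Cp_space p \<Omega> \<Longrightarrow> push 0 u = u"
  using push_apply[of _ 0 u] by (auto simp: fun_eq_iff W_def push_def Cp_space_def)

lemma push_eq_0:
  assumes "\<And>x. x \<notin> L \<Longrightarrow> u x = 0" "y \<notin> (\<psi> ^^ n) ` L"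
  shows "push n u y = 0"
proof (cases "y \<in> (\<psi> ^^ n) ` \<Omega>")
  case True
  then obtain x where x: "x \<in> \<Omega>" "y = (\<psi> ^^ n) x" by blast
  moreover have "x \<notin> L" using assms(2) x by blast
  ultimately show ?thesis using push_apply assms(1) by simp
qed (simp add: push_def)

text \<open>Two open sets cover \<open>\<Omega>\<close>: the range of \<open>\<psi> ^^ n\<close>,
  where the inverse map is of class \<open>p\<close>, and the complement of the compact image of
  \<open>L\<close>, where the function vanishes.\<close>

lemma push_in:
  assumes u: "u \<in> Cp_space p \<Omega>" and L: "compact L" "L \<subseteq> \<Omega>" "\<And>x. x \<notin> L \<Longrightarrow> u x = 0"
  shows "push n u \<in> Cp_space p \<Omega>"
proof -
  define g where "g = inv_into \<Omega> (\<psi> ^^ n)"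
  have gf: "g ((\<psi> ^^ n) x) = x" if "x \<in> \<Omega>" for x
    unfolding g_def using inv_into_f_f[OF \<psi>_funpow_inj that] .
  note inv = Cp_on_inverse_function[OF open_\<Omega> Cp_on_\<psi>_funpow p_ge_1 \<psi>_funpow_deriv_nz gf]
  have oI: "open ((\<psi> ^^ n) ` \<Omega>)" using inv(1) by blast
  have Cg: "Cp_on p ((\<psi> ^^ n) ` \<Omega>) g" using inv(2) by blast
  have "Cp_on p \<Omega> (\<lambda>x. u x * inverse (W n x))"
    by (rule Cp_on_mult[OF open_\<Omega> _ Cp_on_inverse[OF open_\<Omega> Cp_on_W W_nz]])
       (use u in \<open>auto simp: Cp_space_def\<close>)
  then have C1: "Cp_on p ((\<psi> ^^ n) ` \<Omega>) (\<lambda>y. u (g y) * inverse (W n (g y)))"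
    using Cp_on_compose[OF oI open_\<Omega> _ _ Cg, of "\<lambda>x. u x * inverse (W n x)"] gf
    by (auto simp: image_subset_iff)
  have sub: "(\<psi> ^^ n) ` \<Omega> \<subseteq> \<Omega>" using \<psi>_funpow_in by auto
  have cL: "compact ((\<psi> ^^ n) ` L)"
    using continuous_on_subset[OF Cp_on_continuous[OF Cp_on_\<psi>_funpow] L(2)] L(1)
    by (intro compact_continuous_image)
  have "Cp_on p \<Omega> (push n u)"
  proof (rule Cp_on_local[OF open_\<Omega>])
    fix y assume y: "y \<in> \<Omega>"
    show "\<exists>U h. open U \<and> y \<in> U \<and> Cp_on p U h \<and> (\<forall>z\<in>U. push n u z = h z)"
    proof (cases "y \<in> (\<psi> ^^ n) ` \<Omega>")
      case True
      then show ?thesis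
        using oI C1
        by (intro exI[of _ "(\<psi> ^^ n) ` \<Omega>"] exI[of _ "\<lambda>y. u (g y) * inverse (W n (g y))"])
           (auto simp: push_def g_def divide_inverse)
    next
      case False
      then have "y \<in> - ((\<psi> ^^ n) ` L)" using L(2) by blast
      moreover have "open (- ((\<psi> ^^ n) ` L))" using cL compact_imp_closed by blast
      ultimately show ?thesis
        using push_eq_0[of L u _ n] L(3)
        by (intro exI[of _ "- ((\<psi> ^^ n) ` L)"] exI[of _ "\<lambda>_. 0"]) auto
    qed
  qed
  then show ?thesis using sub by (auto simp: Cp_space_def push_def)
qed

text \<open>A single cutoff for \<open>K1 \<union> K2\<close> is used, so that the one condition
  that \<open>L\<close> misses its image removes both cross terms: near the compact sets,
  \<open>push n u\<close> does not disturb \<open>f\<close>, and \<open>T ^^ n\<close> kills the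
  part that comes from \<open>f\<close>.\<close>

lemma mixing: "mixing_on X T"
  unfolding mixing_on_def
proof (intro allI impI, elim conjE)
  fix U V assume "openin X U" "U \<noteq> {}" "openin X V" "V \<noteq> {}"
  obtain f K1 n1 e1 where f: "f \<in> Cp_space p \<Omega>"
    and 1: "compact K1" "K1 \<subseteq> \<Omega>" "e1 > 0" "Cp_ball p \<Omega> K1 n1 e1 f \<subseteq> U"
    using openin_X_obtain[OF \<open>openin X U\<close> \<open>U \<noteq> {}\<close>] by metis
  obtain h K2 n2 e2 where h: "h \<in> Cp_space p \<Omega>"
    and 2: "compact K2" "K2 \<subseteq> \<Omega>" "e2 > 0" "Cp_ball p \<Omega> K2 n2 e2 h \<subseteq> V"
    using openin_X_obtain[OF \<open>openin X V\<close> \<open>V \<noteq> {}\<close>] by metis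
  have K: "compact (K1 \<union> K2)" "K1 \<union> K2 \<subseteq> \<Omega>" using 1 2 by (auto simp: compact_Un)
  obtain c :: "real \<Rightarrow> real" and L N where "\<forall>p. Cp_on p UNIV c" and L: "compact L" "L \<subseteq> \<Omega>" and N: "open N" "K1 \<union> K2 \<subseteq> N"
    and "\<forall>x\<in>N. c x = 1" and "\<forall>x. x \<notin> L \<longrightarrow> c x = 0"
    using smooth_cutoff[OF K(1) open_\<Omega> K(2)] by blast
  then have c: "\<And>p. Cp_on p UNIV c" and c1: "\<And>x. x \<in> N \<Longrightarrow> c x = 1"
    and c0: "\<And>x. x \<notin> L \<Longrightarrow> c x = 0" by blast+
  have NL: "N \<subseteq> L" using c1 c0 by force
  define u where "u = (\<lambda>x. c x *\<^sub>R h x)"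
  have u: "u \<in> Cp_space p \<Omega>" unfolding u_def by (rule cutoff_mult_in[OF c h])
  have u0: "u x = 0" if "x \<notin> L" for x using c0[OF that] by (simp add: u_def)
  obtain n0 where n0: "\<And>n. n \<ge> n0 \<Longrightarrow> (\<psi> ^^ n) ` L \<inter> L = {}" using escapes[OF L L] by blast
  have "(T ^^ n) ` U \<inter> V \<noteq> {}" if "n \<ge> n0" for n
  proof -
    define F where "F = (\<lambda>x. c x *\<^sub>R f x + push n u x)"
    have F: "F \<in> Cp_space p \<Omega>"
      using cutoff_mult_in[OF c f] push_in[OF u L u0, of n] Cp_on_add[OF open_\<Omega>]
      unfolding F_def Cp_space_def by auto
    have "F x = f x" if "x \<in> N" for x
      using push_eq_0[of L u x n] u0 n0[OF \<open>n \<ge> n0\<close>] NL that c1[OF that] by (auto simp: F_def)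
    then have "F \<in> U" using mem_Cp_ball_cong[OF F N(1), of K1 f e1 n1] N 1 by blast
    moreover have "(T ^^ n) F x = h x" if x: "x \<in> N" for x
    proof -
      have x\<Omega>: "x \<in> \<Omega>" using x NL L by blast
      have "c ((\<psi> ^^ n) x) = 0" using c0 n0[OF \<open>n \<ge> n0\<close>] x NL by blast
      then have "F ((\<psi> ^^ n) x) = h x / W n x"
        using x\<Omega> c1[OF x] by (simp add: F_def push_apply u_def)
      then show ?thesis
        using x\<Omega> W_nz[OF x\<Omega>] by (simp add: T_funpow_apply[OF F])
    qed
    then have "(T ^^ n) F \<in> V"
      using mem_Cp_ball_cong[OF T_funpow_in[OF F] N(1), of K2 n h e2 n2] N 2 by blast
    ultimately show ?thesis by blast
  qed
  then show "\<exists>N. \<forall>n\<ge>N. (T ^^ n) ` U \<inter> V \<noteq> {}" by blast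
qed

text \<open>The periodic point is the sum over all integers \<open>j\<close> of the images of the
  cut off function \<open>u\<close> under the powers -\<open>j\<close> of \<open>T ^^ m\<close>,
  where \<open>push\<close> supplies the negative powers. Applying \<open>T ^^ m\<close> shifts the
  index and thus fixes the sum; near \<open>K\<close> only the term with \<open>j = 0\<close>
  survives.\<close>

lemma chaotic: "chaotic_on X T"
  unfolding chaotic_on_def
proof
  show "transitive_on X T"
    using mixing unfolding mixing_on_def transitive_on_def by (meson order_refl)
  show "X closure_of periodic_points X T = topspace X"
    unfolding dense_intersects_open
  proof (intro allI impI, elim conjE)
    fix V assume "openin X V" "V \<noteq> {}"
    obtain f K n e where f: "f \<in> Cp_space p \<Omega>"
      and K: "compact K" "K \<subseteq> \<Omega>" "e > 0" "Cp_ball p \<Omega> K n e f \<subseteq> V"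
      using openin_X_obtain[OF \<open>openin X V\<close> \<open>V \<noteq> {}\<close>] by metis
    obtain c :: "real \<Rightarrow> real" and L N where "\<forall>p. Cp_on p UNIV c" and L: "compact L" "L \<subseteq> \<Omega>" and N: "open N" "K \<subseteq> N"
      and "\<forall>x\<in>N. c x = 1" and "\<forall>x. x \<notin> L \<longrightarrow> c x = 0"
      using smooth_cutoff[OF K(1) open_\<Omega> K(2)] by blast
    then have c: "\<And>p. Cp_on p UNIV c" and c1: "\<And>x. x \<in> N \<Longrightarrow> c x = 1"
      and c0: "\<And>x. x \<notin> L \<Longrightarrow> c x = 0" by blast+
    have NL: "N \<subseteq> L" using c1 c0 by force
    define u where "u = (\<lambda>x. c x *\<^sub>R f x)"
    have u: "u \<in> Cp_space p \<Omega>" unfolding u_def by (rule cutoff_mult_in[OF c f])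
    have u0: "u x = 0" if "x \<notin> L" for x using c0[OF that] by (simp add: u_def)
    obtain n0 where n0: "\<And>n. n \<ge> n0 \<Longrightarrow> (\<psi> ^^ n) ` L \<inter> L = {}" using escapes[OF L L] by blast
    define m where "m = max n0 1"
    have m: "m \<ge> 1" "\<And>n. n \<ge> m \<Longrightarrow> (\<psi> ^^ n) ` L \<inter> L = {}" using n0 by (auto simp: m_def)
    \<comment> \<open>Indices count pushes forward: \<open>T ^^ m\<close> lowers the index by one,
      so negative indices are powers of \<open>T\<close> applied to \<open>u\<close>.\<close>
    define E where "E = (\<lambda>j::int. if j \<ge> 0 then push (nat j * m) u else (T ^^ (nat (- j) * m)) u)"
    have E_pos: "E (int j) = push (j * m) u" for j by (simp add: E_def)
    have E_neg: "E (- int j) = (T ^^ (j * m)) u" for j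
      using push_0[OF u] by (cases "j = 0") (auto simp: E_def)
    have E_in: "E j \<in> Cp_space p \<Omega>" for j
      unfolding E_def using push_in[OF u L u0] T_funpow_in[OF u] by simp
    have E_nz: "(\<exists>x\<in>L. y = (\<psi> ^^ (nat \<bar>j\<bar> * m)) x) \<or> (\<psi> ^^ (nat \<bar>j\<bar> * m)) y \<in> L" if "E j y \<noteq> 0" for j y
    proof (cases "j \<ge> 0")
      case True
      then show ?thesis using that push_eq_0[of L u y "nat j * m"] u0 by (auto simp: E_def)
    next
      case False
      then show ?thesis using that u0 by (auto simp: E_def T_funpow_apply[OF u] split: if_splits)
    qed
    \<comment> \<open>For large positive \<open>j\<close> the support lies in a far image of
      \<open>L\<close>, which misses \<open>M\<close>; for large negative \<open>j\<close> a nonzero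
      value on \<open>M\<close> would need a far image of \<open>M\<close> to meet
      \<open>L\<close>.\<close>
    have fin: "finite {j. \<exists>y\<in>M. E j y \<noteq> 0}" if M: "compact M" "M \<subseteq> \<Omega>" for M
    proof -
      obtain a b where a: "\<And>n. n \<ge> a \<Longrightarrow> (\<psi> ^^ n) ` L \<inter> M = {}" and b: "\<And>n. n \<ge> b \<Longrightarrow> (\<psi> ^^ n) ` M \<inter> L = {}"
        using escapes[OF L M] escapes[OF M L] by metis
      have "nat \<bar>j\<bar> * m < a + b" if "y \<in> M" "E j y \<noteq> 0" for j y
      proof (rule ccontr)
        assume "\<not> nat \<bar>j\<bar> * m < a + b"
        then have "nat \<bar>j\<bar> * m \<ge> a" "nat \<bar>j\<bar> * m \<ge> b" by auto
        then show False using E_nz[OF that(2)] a b that(1) by blast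
      qed
      then have "nat \<bar>j\<bar> < a + b" if "y \<in> M" "E j y \<noteq> 0" for j y
        using that m(1) by (metis le_trans mult.right_neutral mult_le_mono2 not_le)
      then have "{j. \<exists>y\<in>M. E j y \<noteq> 0} \<subseteq> {- int (a + b)..int (a + b)}" by fastforce
      then show ?thesis using finite_subset by blast
    qed
    define F where "F = locally_finite_sum E"
    have F: "F \<in> Cp_space p \<Omega>"
      unfolding F_def by (rule locally_finite_sum_in_Cp_space[OF open_\<Omega> E_in fin])
    have shift: "W m x * E j ((\<psi> ^^ m) x) = E (j - 1) x" if x: "x \<in> \<Omega>" for j x
    proof (cases "j \<ge> 1")
      case True
      then obtain i where j: "j = int (Suc i)"
        by (metis nonneg_int_cases Suc_pred' int_one_le_iff_zero_less of_nat_0_less_iff order.trans zero_le_one zero_less_one_class.zero_le_one)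
      show ?thesis
      proof (cases "x \<in> (\<psi> ^^ (i * m)) ` \<Omega>")
        case True
        then obtain z where z: "z \<in> \<Omega>" "x = (\<psi> ^^ (i * m)) z" by blast
        have eq: "(\<psi> ^^ m) x = (\<psi> ^^ (Suc i * m)) z" unfolding z by (simp add: funpow_add)
        have "W (Suc i * m) z = W (i * m) z * W m x"
          using W_add[of "i * m" m z] z by (simp add: add.commute)
        then show ?thesis
          using W_nz[OF x, of m] E_pos[of i] E_pos[of "Suc i"] push_apply[OF z(1), of "i * m" u]
            push_apply[OF z(1), of "Suc i * m" u] by (simp add: j eq z(2)[symmetric])
      next
        case False
        \<comment> \<open>Injectivity prevents a point outside the range from entering the range of
          the longer iterate, so both sides are zero by the default value of
          \<open>push\<close>.\<close>
        have "(\<psi> ^^ m) x \<notin> (\<psi> ^^ (Suc i * m)) ` \<Omega>"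
        proof
          assume "(\<psi> ^^ m) x \<in> (\<psi> ^^ (Suc i * m)) ` \<Omega>"
          then obtain z where z: "z \<in> \<Omega>" "(\<psi> ^^ m) x = (\<psi> ^^ m) ((\<psi> ^^ (i * m)) z)"
            by (auto simp: funpow_add)
          then have "x = (\<psi> ^^ (i * m)) z" using \<psi>_funpow_inj x \<psi>_funpow_in by (metis inj_onD)
          then show False using False z by blast
        qed
        then show ?thesis
          using False E_pos[of i] E_pos[of "Suc i"] by (simp add: j push_def)
      qed
    next
      case False
      then obtain i where j: "j = - int i" by (metis int_zle_neg nonpos_int_cases not_le zle_iff_zadd int_one_le_iff_zero_less)
      have j1: "j - 1 = - int (Suc i)" using j by simp
      have "W (Suc i * m) x = W m x * W (i * m) ((\<psi> ^^ m) x)" using W_add[of m "i * m" x] by simp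
      moreover have "(\<psi> ^^ (Suc i * m)) x = (\<psi> ^^ (i * m)) ((\<psi> ^^ m) x)"
        by (metis add.commute comp_apply funpow_add mult_Suc)
      ultimately show ?thesis
        unfolding j1 unfolding j E_neg T_funpow_apply[OF u]
        using x \<psi>_funpow_in[OF x, of m] by simp
    qed
    have "(T ^^ m) F = F"
    proof
      fix x
      show "(T ^^ m) F x = F x"
      proof (cases "x \<in> \<Omega>")
        case True
        have E_eq_0_iff: "E j ((\<psi> ^^ m) x) = 0 \<longleftrightarrow> E (j - 1) x = 0" for j
          using shift[OF True, of j] W_nz[OF True, of m] by (metis mult_eq_0_iff)
        have "(T ^^ m) F x = W m x * F ((\<psi> ^^ m) x)"
          using True by (simp add: T_funpow_apply[OF F])
        also have "\<dots> = (\<Sum>j | E j ((\<psi> ^^ m) x) \<noteq> 0. W m x * E j ((\<psi> ^^ m) x))"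
          by (simp add: F_def locally_finite_sum_def sum_distrib_left)
        also have "\<dots> = (\<Sum>j | E j x \<noteq> 0. E j x)"
          by (rule sum.reindex_bij_witness[of _ "\<lambda>j. j + 1" "\<lambda>j. j - 1"])
             (auto simp: E_eq_0_iff shift[OF True])
        finally show ?thesis by (simp add: F_def locally_finite_sum_def)
      next
        case False
        then show ?thesis using F by (simp add: T_funpow_apply[OF F] Cp_space_def)
      qed
    qed
    then have "F \<in> periodic_points X T"
      unfolding periodic_points_def using m(1) F topspace_X by auto
    moreover have "F x = f x" if x: "x \<in> N" for x
    proof -
      have "E j x = 0" if "j \<noteq> 0" for j
      proof (rule ccontr)
        assume "E j x \<noteq> 0"
        moreover have "nat \<bar>j\<bar> * m \<ge> m" using that by (cases "nat \<bar>j\<bar>") auto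
        ultimately show False using E_nz[of j x] m(2)[of "nat \<bar>j\<bar> * m"] x NL by blast
      qed
      then have "F x = E 0 x" unfolding F_def by (rule locally_finite_sum_single)
      also have "\<dots> = (T ^^ 0) u x" using E_neg[of 0] by simp
      finally show ?thesis using c1[OF x] by (simp add: u_def)
    qed
    then have "F \<in> V" using mem_Cp_ball_cong[OF F N(1), of K f e n] N K by blast
    ultimately show "periodic_points X T \<inter> V \<noteq> {}" by blast
  qed
qed

text \<open>Even the unscaled orbit of \<open>G\<close> is dense. At time \<open>\<nu> k\<close> the
  \<open>k\<close>-th piece unfolds to a prescribed polynomial near \<open>C k\<close>, while the
  other pieces vanish there because the transported supports are disjoint.\<close>

lemma supercyclic: "supercyclic_on X fun_scale T"
proof -
  have "\<exists>C. (\<forall>k::nat. compact (C k)) \<and> (\<forall>k. C k \<subseteq> \<Omega>) \<and>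
      (\<forall>M. compact M \<longrightarrow> M \<subseteq> \<Omega> \<longrightarrow> (\<exists>N. \<forall>k\<ge>N. M \<subseteq> C k))"
  proof (rule open_Union_compact_subsets[OF open_\<Omega>], goal_cases)
    case (1 C)
    then show ?case by (intro exI[of _ C]) blast
  qed
  then obtain C where C: "\<And>k::nat. compact (C k)" "\<And>k. C k \<subseteq> \<Omega>"
    and C_ex: "\<And>M. compact M \<Longrightarrow> M \<subseteq> \<Omega> \<Longrightarrow> \<exists>N. \<forall>k\<ge>N. M \<subseteq> C k" by metis
  obtain q :: "nat \<Rightarrow> 'a poly" where q: "\<And>n f R \<epsilon>. Cp_on (enat n) UNIV f \<Longrightarrow> R > 0 \<Longrightarrow> \<epsilon> > 0 \<Longrightarrow>
      \<exists>i. \<forall>k\<le>n. \<forall>x\<in>{-R..R}. norm (nderiv k f x - nderiv k (pfun (q i)) x) < \<epsilon>"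
    using countable_dense_polys by blast
  have "\<exists>c L N. (\<forall>p. Cp_on p UNIV c) \<and> compact L \<and> L \<subseteq> \<Omega> \<and> open N \<and> C k \<subseteq> N \<and>
      (\<forall>x\<in>N. c x = (1::real)) \<and> (\<forall>x. x \<notin> L \<longrightarrow> c x = 0)" for k
    using smooth_cutoff[OF C(1) open_\<Omega> C(2)] .
  then obtain c L N where c: "\<And>k p. Cp_on p UNIV (c k)" and L: "\<And>k. compact (L k)" "\<And>k. L k \<subseteq> \<Omega>"
    and N: "\<And>k. open (N k)" "\<And>k. C k \<subseteq> N k"
    and c1: "\<And>k x. x \<in> N k \<Longrightarrow> c k x = (1::real)" and c0: "\<And>k x. x \<notin> L k \<Longrightarrow> c k x = 0" by metis
  have NL: "N k \<subseteq> L k" for k using c1 c0 by force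
  \<comment> \<open>Pairing makes each polynomial recur at arbitrarily late \<open>k\<close>, hence
    on arbitrarily large members of the exhaustion \<open>C\<close>.\<close>
  define Q where "Q = (\<lambda>k. pfun (q (fst (prod_decode k))))"
  define u where "u = (\<lambda>k x. c k x *\<^sub>R extend0 \<Omega> (Q k) x)"
  have "extend0 \<Omega> (Q k) \<in> Cp_space p \<Omega>" for k
    unfolding Q_def by (rule extend0_in_Cp_space[OF open_\<Omega> Cp_on_mono[OF Cp_on_pfun order_refl subset_UNIV]])
  then have u: "u k \<in> Cp_space p \<Omega>" for k unfolding u_def by (rule cutoff_mult_in[OF c])
  have u0: "u k x = 0" if "x \<notin> L k" for k x using c0[OF that] by (simp add: u_def)
  \<comment> \<open>A state is a time together with a compact set that collects the earlier images.
    Avoiding that set makes the supports disjoint; avoiding \<open>C k\<close> makes the family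
    locally finite.\<close>
  have "\<exists>s. \<forall>k. (compact (snd (s k)) \<and> snd (s k) \<subseteq> \<Omega> \<and> (\<psi> ^^ fst (s k)) ` L k \<inter> (C k \<union> snd (s k)) = {}) \<and>
      snd (s (Suc k)) = snd (s k) \<union> (\<psi> ^^ fst (s k)) ` L k"
  proof (rule dependent_nat_choice)
    obtain n where "(\<psi> ^^ n) ` L 0 \<inter> C 0 = {}" using escapes[OF L C(1,2)] by blast
    then show "\<exists>s. compact (snd s) \<and> snd s \<subseteq> \<Omega> \<and> (\<psi> ^^ fst s) ` L 0 \<inter> (C 0 \<union> snd s) = {}"
      by (intro exI[of _ "(n, {})"]) auto
  next
    fix s k assume s: "compact (snd s) \<and> snd s \<subseteq> \<Omega> \<and> (\<psi> ^^ fst s) ` L k \<inter> (C k \<union> snd s) = {}"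
    define M where "M = snd s \<union> (\<psi> ^^ fst s) ` L k"
    have M: "compact M" "M \<subseteq> \<Omega>"
      using s L[of k] \<psi>_funpow_in continuous_on_subset[OF Cp_on_continuous[OF Cp_on_\<psi>_funpow] L(2)]
      unfolding M_def by (auto intro!: compact_Un compact_continuous_image)
    obtain n where "(\<psi> ^^ n) ` L (Suc k) \<inter> (C (Suc k) \<union> M) = {}"
      using escapes[OF L, of "C (Suc k) \<union> M" "Suc k"] M C by (auto simp: compact_Un)
    then have "compact (snd (n, M)) \<and> snd (n, M) \<subseteq> \<Omega> \<and>
        (\<psi> ^^ fst (n, M)) ` L (Suc k) \<inter> (C (Suc k) \<union> snd (n, M)) = {}"
      using M by simp
    then show "\<exists>s'. (compact (snd s') \<and> snd s' \<subseteq> \<Omega> \<and> (\<psi> ^^ fst s') ` L (Suc k) \<inter> (C (Suc k) \<union> snd s') = {}) \<and>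
        snd s' = snd s \<union> (\<psi> ^^ fst s) ` L k"
      unfolding M_def[symmetric] by (metis snd_conv)
  qed
  then obtain s where "\<forall>k. (compact (snd (s k)) \<and> snd (s k) \<subseteq> \<Omega> \<and> (\<psi> ^^ fst (s k)) ` L k \<inter> (C k \<union> snd (s k)) = {}) \<and>
      snd (s (Suc k)) = snd (s k) \<union> (\<psi> ^^ fst (s k)) ` L k" ..
  then have s: "(\<psi> ^^ fst (s k)) ` L k \<inter> (C k \<union> snd (s k)) = {}"
    "snd (s (Suc k)) = snd (s k) \<union> (\<psi> ^^ fst (s k)) ` L k" for k by simp_all
  define \<nu> where "\<nu> k = fst (s k)" for k
  have in_snd: "(\<psi> ^^ \<nu> j) ` L j \<subseteq> snd (s k)" if "j < k" for j k
    using that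
  proof (induction k)
    case (Suc k)
    then show ?case using s(2)[of k] unfolding \<nu>_def by (cases "j = k") auto
  qed simp
  have disj_less: "(\<psi> ^^ \<nu> j) ` L j \<inter> (\<psi> ^^ \<nu> k) ` L k = {}" if "j < k" for j k
    using in_snd[OF that] s(1)[of k] unfolding \<nu>_def by blast
  have disj: "(\<psi> ^^ \<nu> j) ` L j \<inter> (\<psi> ^^ \<nu> k) ` L k = {}" if "j \<noteq> k" for j k
    using that disj_less[of j k] disj_less[of k j] by (metis Int_commute nat_neq_iff)
  define E where "E = (\<lambda>k. push (\<nu> k) (u k))"
  have E_in: "E k \<in> Cp_space p \<Omega>" for k unfolding E_def by (rule push_in[OF u L u0])
  have E0: "E k y = 0" if "y \<notin> (\<psi> ^^ \<nu> k) ` L k" for k y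
    unfolding E_def by (rule push_eq_0[OF u0 that])
  have fin: "finite {k. \<exists>y\<in>M. E k y \<noteq> 0}" if M: "compact M" "M \<subseteq> \<Omega>" for M
  proof -
    obtain k0 where "\<forall>k\<ge>k0. M \<subseteq> C k" using C_ex[OF M] by blast
    then have "{k. \<exists>y\<in>M. E k y \<noteq> 0} \<subseteq> {..<k0}"
      using E0 s(1) unfolding \<nu>_def by (fastforce simp: not_le[symmetric])
    then show ?thesis using finite_subset by blast
  qed
  define G where "G = locally_finite_sum E"
  have G: "G \<in> Cp_space p \<Omega>"
    unfolding G_def by (rule locally_finite_sum_in_Cp_space[OF open_\<Omega> E_in fin])
  have TG: "(T ^^ \<nu> k) G x = Q k x" if x: "x \<in> N k" for k x
  proof -
    have xL: "x \<in> L k" "x \<in> \<Omega>" using x NL L by blast+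
    have "G ((\<psi> ^^ \<nu> k) x) = E k ((\<psi> ^^ \<nu> k) x)"
      unfolding G_def by (rule locally_finite_sum_single, rule E0) (use disj xL in blast)
    then show ?thesis
      using xL W_nz c1[OF x] by (simp add: T_funpow_apply[OF G] E_def push_apply u_def extend0_def)
  qed
  have "X closure_of {fun_scale c ((T ^^ n) G) | c n. True} = topspace X"
    unfolding dense_intersects_open
  proof (intro allI impI, elim conjE)
    fix V assume "openin X V" "V \<noteq> {}"
    obtain f K n e where f: "f \<in> Cp_space p \<Omega>"
      and K: "compact K" "K \<subseteq> \<Omega>" "enat n \<le> p" "e > 0" "Cp_ball p \<Omega> K n e f \<subseteq> V"
      using openin_X_obtain[OF \<open>openin X V\<close> \<open>V \<noteq> {}\<close>] by metis
    obtain d :: "real \<Rightarrow> real" and D N' where "\<forall>p. Cp_on p UNIV d" and D: "compact D" "D \<subseteq> \<Omega>" and N': "open N'" "K \<subseteq> N'"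
      and "\<forall>x\<in>N'. d x = 1" and "\<forall>x. x \<notin> D \<longrightarrow> d x = 0"
      using smooth_cutoff[OF K(1) open_\<Omega> K(2)] by blast
    then have d: "\<And>p. Cp_on p UNIV d" and d1: "\<And>x. x \<in> N' \<Longrightarrow> d x = 1"
      and d0: "\<And>x. x \<notin> D \<Longrightarrow> d x = 0" by blast+
    \<comment> \<open>The polynomials approximate functions on the whole line. Cutting
      \<open>f\<close> off makes its extension by zero smooth of order \<open>n\<close> there and
      changes nothing near \<open>K\<close>.\<close>
    define g where "g = (\<lambda>x. d x *\<^sub>R f x)"
    have "g \<in> Cp_space p \<Omega>" unfolding g_def by (rule cutoff_mult_in[OF d f])
    then have "Cp_on (enat n) \<Omega> g" using K(3) Cp_on_iff by (auto simp: Cp_space_def)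
    then have "Cp_on (enat n) UNIV g"
    proof (intro Cp_on_local[OF open_UNIV])
      fix x
      have "open (- D)" using D compact_imp_closed by blast
      then show "\<exists>U h. open U \<and> x \<in> U \<and> Cp_on (enat n) U h \<and> (\<forall>y\<in>U. g y = h y)"
        if "Cp_on (enat n) \<Omega> g"
        using that open_\<Omega> D d0
        by (cases "x \<in> \<Omega>")
           (fastforce intro: exI[of _ \<Omega>], fastforce intro!: exI[of _ "- D"] exI[of _ "\<lambda>_. 0"] simp: g_def)
    qed
    moreover obtain R where R: "R > 0" "K \<subseteq> {-R..R}"
      using compact_imp_bounded[OF K(1)] unfolding bounded_pos by (auto simp: abs_le_iff subset_iff minus_le_iff)
    ultimately obtain i where i: "\<And>k x. k \<le> n \<Longrightarrow> x \<in> K \<Longrightarrow> norm (nderiv k g x - nderiv k (pfun (q i)) x) < e"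
      using q[of n g R e] K(4) by blast
    obtain k1 where k1: "\<forall>k\<ge>k1. K \<subseteq> C k" using C_ex[OF K(1,2)] by blast
    define k where "k = prod_encode (i, k1)"
    have "k \<ge> k1" unfolding k_def by (rule le_prod_encode_2)
    then have KN: "K \<subseteq> N k" using k1 N(2) by blast
    have Qk: "Q k = pfun (q i)" by (simp add: Q_def k_def)
    have "norm (nderiv l ((T ^^ \<nu> k) G) x - nderiv l f x) < e" if "l \<le> n" "x \<in> K" for l x
    proof -
      have "nderiv l ((T ^^ \<nu> k) G) x = nderiv l (pfun (q i)) x"
        by (rule nderiv_cong_open[OF N(1)[of k]]) (use TG KN that Qk in auto)
      moreover have "nderiv l g x = nderiv l f x"
        by (rule nderiv_cong_open[OF N'(1)]) (use N' that d1 in \<open>auto simp: g_def\<close>)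
      ultimately show ?thesis using i[OF that] by (simp add: norm_minus_commute)
    qed
    then have "(T ^^ \<nu> k) G \<in> V" using K(5) T_funpow_in[OF G] unfolding Cp_ball_def by blast
    moreover have "(T ^^ \<nu> k) G = fun_scale 1 ((T ^^ \<nu> k) G)" by simp
    ultimately show "{fun_scale c ((T ^^ n) G) | c n. True} \<inter> V \<noteq> {}" by blast
  qed
  then show ?thesis unfolding supercyclic_on_def using G topspace_X by blast
qed

end

section \<open>Necessary conditions\<close>

text \<open>The displacement \<open>D z = A z - z\<close> satisfies \<open>D (A z) = a D z\<close>.\<close>

lemma affine_orbit_not_dense:
  fixes c :: "'k::real_normed_field" and a :: real
  defines "A \<equiv> \<lambda>z. c + a *\<^sub>R z" and "D \<equiv> \<lambda>z. c + (a - 1) *\<^sub>R z"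
  assumes B: "bounded B" and "\<epsilon> > 0" and sep: "\<And>z. z \<in> B \<Longrightarrow> D z = 0 \<or> \<epsilon> \<le> norm (D z)"
  shows "\<exists>V. open V \<and> V \<noteq> {} \<and> (\<forall>z\<in>B. \<forall>n. (A ^^ n) z \<notin> V)"
proof -
  obtain M where M: "M > 0" "\<And>z. z \<in> B \<Longrightarrow> norm z \<le> M" using B bounded_pos by metis
  have DA: "D (A z) = a *\<^sub>R D z" for z by (simp add: A_def D_def algebra_simps)
  have DAn: "norm (D ((A ^^ n) z)) = \<bar>a\<bar> ^ n * norm (D z)" for n z
    by (induction n) (auto simp: DA)
  have contD: "continuous_on UNIV D" unfolding D_def by (intro continuous_intros)
  have surjD: "\<exists>z. D z = w" if "a \<noteq> 1" for w
    by (rule exI[of _ "inverse (a - 1) *\<^sub>R (w - c)"]) (use that in \<open>simp add: D_def\<close>)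
  consider "a = 1" "c = 0" | "a = 1" "c \<noteq> 0" | "a \<noteq> 1" "\<bar>a\<bar> \<le> 1" | "\<bar>a\<bar> > 1" by linarith
  then show ?thesis
  proof cases
    case 1
    then have An: "(A ^^ n) z = z" for n z by (induction n) (auto simp: A_def)
    have "norm (of_real (M + 1) :: 'k) = M + 1" using M(1) by (simp only: norm_of_real)
    then have "of_real (M + 1) \<in> - cball (0::'k) M" by (simp del: of_real_add)
    then have "- cball (0::'k) M \<noteq> {}" by blast
    then show ?thesis using M(2) An by (intro exI[of _ "- cball 0 M"]) auto
  next
    case 2
    then have An: "(A ^^ n) z = z + of_nat n * c" for n z
      by (induction n) (auto simp: A_def algebra_simps)
    \<comment> \<open>The avoided ball is centred at -\<open>t\<close> c, against the direction of
      translation, and so far out that starting values of norm at most \<open>M\<close> never come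
      within distance 1 of its centre.\<close>
    obtain t :: nat where t: "(M + 1) / norm c < t" using reals_Archimedean2 by blast
    then have t: "M + 1 < t * norm c" using 2 by (simp add: field_simps)
    have "(A ^^ n) z \<notin> ball (- (of_nat t * c)) 1" if "z \<in> B" for n z
    proof -
      have "t * norm c \<le> (n + t) * norm c" by (intro mult_right_mono) auto
      also have "\<dots> = norm (of_nat (n + t) * c)" by (simp add: norm_mult del: of_nat_add)
      also have "\<dots> \<le> norm (z + of_nat (n + t) * c) + norm z"
        using norm_triangle_ineq4[of "z + of_nat (n + t) * c" z] by simp
      finally have "1 < norm (z + of_nat (n + t) * c)" using t M(2)[OF that] by simp
      moreover have "dist (- (of_nat t * c)) ((A ^^ n) z) = norm (z + of_nat (n + t) * c)"
        by (subst dist_commute) (simp add: An dist_norm algebra_simps)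
      ultimately show ?thesis by simp
    qed
    then show ?thesis by (intro exI[of _ "ball (- (of_nat t * c)) 1"]) auto
  next
    case 3
    \<comment> \<open>A bound for the displacement on \<open>B\<close>; it persists along orbits
      because \<open>\<bar>a\<bar> \<le> 1\<close>.\<close>
    define M' where "M' = norm c + \<bar>a - 1\<bar> * M"
    have "norm (D ((A ^^ n) z)) \<le> M'" if "z \<in> B" for n z
    proof -
      have "\<bar>a\<bar> ^ n * norm (D z) \<le> 1 * norm (D z)"
        using 3 by (intro mult_right_mono power_le_one) auto
      also have "norm (D z) \<le> norm c + \<bar>a - 1\<bar> * norm z"
        unfolding D_def by (rule order.trans[OF norm_triangle_ineq]) simp
      also have "\<dots> \<le> M'" unfolding M'_def using M(2)[OF that] by (intro add_left_mono mult_left_mono) auto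
      finally show ?thesis by (simp add: DAn)
    qed
    moreover have "open {z. M' < norm (D z)}"
      by (intro open_Collect_less continuous_intros contD)
    moreover obtain z where "D z = of_real (\<bar>M'\<bar> + 1)" using surjD 3 by blast
    then have "norm (D z) = \<bar>\<bar>M'\<bar> + 1\<bar>" by (simp only: norm_of_real)
    then have "z \<in> {z. M' < norm (D z)}" by simp
    then have "{z. M' < norm (D z)} \<noteq> {}" by blast
    ultimately show ?thesis by (intro exI[of _ "{z. M' < norm (D z)}"]) (simp add: not_less)
  next
    case 4
    \<comment> \<open>Zero displacements stay zero and the others start at \<open>\<epsilon>\<close>
      or more and do not decrease, so the punctured range below \<open>\<epsilon>\<close> is never
      entered.\<close>
    have "\<not> (0 < norm (D ((A ^^ n) z)) \<and> norm (D ((A ^^ n) z)) < \<epsilon>)" if "z \<in> B" for n z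
    proof (cases "D z = 0")
      case False
      have "1 * norm (D z) \<le> \<bar>a\<bar> ^ n * norm (D z)" using 4 by (intro mult_right_mono one_le_power) auto
      then show ?thesis using sep[OF that] False unfolding DAn by linarith
    qed (simp add: DAn)
    moreover have "open {z. 0 < norm (D z) \<and> norm (D z) < \<epsilon>}"
      by (intro open_Collect_conj open_Collect_less continuous_intros contD)
    moreover have "a \<noteq> 1" using 4 by auto
    then obtain z where "D z = of_real (\<epsilon> / 2)" using surjD by blast
    then have "norm (D z) = \<epsilon> / 2" using \<open>\<epsilon> > 0\<close> by (simp only: norm_of_real)
    then have "z \<in> {z. 0 < norm (D z) \<and> norm (D z) < \<epsilon>}" using \<open>\<epsilon> > 0\<close> by (auto simp del: zero_less_norm_iff)
    ultimately show ?thesis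
      by (intro exI[of _ "{z. 0 < norm (D z) \<and> norm (D z) < \<epsilon>}"]) blast
  qed
qed

text \<open>Supplies the open set of starting values needed for transitive operators. For a
  different from 1 it is a ball at distance at least 1 from the fixed point \<open>w\<close> of the
  affine map; for a = 1 the displacement is constant.\<close>

lemma ex_open_affine_separated:
  fixes c :: "'k::real_normed_field" and a :: real
  defines "D \<equiv> \<lambda>z. c + (a - 1) *\<^sub>R z"
  shows "\<exists>B \<epsilon>. open B \<and> B \<noteq> {} \<and> bounded B \<and> \<epsilon> > 0 \<and> (\<forall>z\<in>B. D z = 0 \<or> \<epsilon> \<le> norm (D z))"
proof (cases "a = 1")
  case True
  then show ?thesis
    by (intro exI[of _ "ball 0 1"] exI[of _ "if c = 0 then 1 else norm c"]) (auto simp: D_def)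
next
  case False
  define w where "w = inverse (a - 1) *\<^sub>R (- c)"
  have "(a - 1) *\<^sub>R w = - c" using False by (simp add: w_def)
  then have D: "D z = (a - 1) *\<^sub>R (z - w)" for z by (simp add: D_def scaleR_right_diff_distrib)
  have "\<bar>a - 1\<bar> \<le> norm (D z)" if "z \<in> ball (w + 2) 1" for z
  proof -
    have "norm (z - w) \<ge> 1"
      using norm_triangle_ineq2[of 2 "w + 2 - z"] that by (simp add: dist_norm norm_minus_commute)
    then have "\<bar>a - 1\<bar> * 1 \<le> \<bar>a - 1\<bar> * norm (z - w)" by (intro mult_left_mono) auto
    then show ?thesis by (simp add: D)
  qed
  then show ?thesis
    using False by (intro exI[of _ "ball (w + 2) 1"] exI[of _ "\<bar>a - 1\<bar>"]) auto
qed

section \<open>Quotients of functionals along orbits\<close>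

context weighted_composition
begin

text \<open>The common form of the two hypotheses: a supercyclic vector gives such a singleton, and
  for a transitive operator every nonempty open set is of this kind.\<close>

definition projectively_dense :: "(real \<Rightarrow> 'k) set \<Rightarrow> bool" where
  "projectively_dense G \<longleftrightarrow> G \<subseteq> Cp_space p \<Omega> \<and>
    (\<forall>V. openin X V \<and> V \<noteq> {} \<longrightarrow> (\<exists>g\<in>G. \<exists>n c. fun_scale c ((T ^^ n) g) \<in> V))"

text \<open>Homogeneity makes the quotient of the two functionals blind to scalars; joint
  surjectivity lets it take every value.\<close>

definition functional_pair :: "((real \<Rightarrow> 'k) \<Rightarrow> 'k) \<Rightarrow> ((real \<Rightarrow> 'k) \<Rightarrow> 'k) \<Rightarrow> bool" where
  "functional_pair \<Phi> \<Psi> \<longleftrightarrow> continuous_map X euclidean \<Phi> \<and> continuous_map X euclidean \<Psi> \<and>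
    (\<forall>f\<in>Cp_space p \<Omega>. \<forall>c. \<Phi> (fun_scale c f) = c * \<Phi> f \<and> \<Psi> (fun_scale c f) = c * \<Psi> f) \<and>
    (\<forall>a b. \<exists>f\<in>Cp_space p \<Omega>. \<Phi> f = a \<and> \<Psi> f = b)"

lemma extend0_pfun_in: "extend0 \<Omega> (pfun P) \<in> Cp_space p \<Omega>"
  by (rule extend0_in_Cp_space[OF open_\<Omega> Cp_on_mono[OF Cp_on_pfun order_refl subset_UNIV]])

lemma continuous_map_eval:
  assumes "x \<in> \<Omega>"
  shows "continuous_map X euclidean (\<lambda>f. f x)"
  using continuous_map_nderiv[OF open_\<Omega> assms, of 0 p] by (simp add: zero_enat_def[symmetric])

lemma functional_pair_points:
  assumes x: "x \<in> \<Omega>" and y: "y \<in> \<Omega>" and "x \<noteq> y"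
  shows "functional_pair (\<lambda>f. f x) (\<lambda>f. f y)"
proof -
  have "\<exists>f\<in>Cp_space p \<Omega>. f x = a \<and> f y = b" for a b :: 'k
  proof -
    define \<beta> where "\<beta> = (b - a) / of_real (y - x)"
    have "of_real (y - x) \<noteq> (0::'k)" using assms(3) by (simp del: of_real_diff)
    then have "\<beta> * (of_real y - of_real x) = b - a" by (simp add: \<beta>_def)
    then show ?thesis
      by (intro bexI[OF _ extend0_pfun_in[of "[:a - \<beta> * of_real x, \<beta>:]"]])
         (use x y in \<open>simp add: extend0_def pfun_def algebra_simps\<close>)
  qed
  then show ?thesis
    unfolding functional_pair_def using continuous_map_eval x y by simp
qed

lemma Cp_space_has_vector_derivative:
  assumes "f \<in> Cp_space p \<Omega>" "x \<in> \<Omega>"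
  shows "(f has_vector_derivative vector_derivative f (at x)) (at x)"
  using Cp_on_has_vector_derivative[OF _ assms(2) p_ge_1] assms(1) by (auto simp: Cp_space_def)

lemma functional_pair_jet:
  assumes x: "x \<in> \<Omega>"
  shows "functional_pair (\<lambda>f. f x) (\<lambda>f. vector_derivative f (at x))"
proof -
  have "\<exists>f\<in>Cp_space p \<Omega>. f x = a \<and> vector_derivative f (at x) = b" for a b :: 'k
  proof -
    have "vector_derivative (extend0 \<Omega> (pfun [:a - b * of_real x, b:])) (at x) = b"
      using nderiv_extend0[OF open_\<Omega> x, of "Suc 0" "pfun [:a - b * of_real x, b:]"]
      by (simp add: nderiv_Suc vector_derivative_at[OF pfun_has_vector_derivative])
         (simp add: pfun_def pderiv_pCons)
    then show ?thesis
      by (intro bexI[OF _ extend0_pfun_in[of "[:a - b * of_real x, b:]"]])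
         (use x in \<open>simp add: extend0_def[of _ "pfun _"] pfun_def\<close>)
  qed
  moreover have "continuous_map X euclidean (\<lambda>f. vector_derivative f (at x))"
    using continuous_map_nderiv[OF open_\<Omega> x, of "Suc 0" p] p_ge_1
    by (simp add: nderiv_Suc one_enat_def)
  moreover have "vector_derivative (fun_scale c f) (at x) = c * vector_derivative f (at x)"
    if "f \<in> Cp_space p \<Omega>" for f :: "real \<Rightarrow> 'k" and c
    by (rule vector_derivative_at)
       (rule bounded_linear.has_vector_derivative[OF bounded_linear_mult_right
         Cp_space_has_vector_derivative[OF that x]])
  ultimately show ?thesis
    unfolding functional_pair_def using continuous_map_eval[OF x] by simp
qed

lemma openin_ratio:
  assumes pair: "functional_pair \<Phi> \<Psi>" and V: "open V" "V \<noteq> {}"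
  shows "openin X {f \<in> Cp_space p \<Omega>. \<Phi> f \<noteq> 0 \<and> \<Psi> f / \<Phi> f \<in> V}" (is ?th1)
    and "{f \<in> Cp_space p \<Omega>. \<Phi> f \<noteq> 0 \<and> \<Psi> f / \<Phi> f \<in> V} \<noteq> {}" (is ?th2)
proof -
  have "continuous_map X (prod_topology euclidean euclidean) (\<lambda>f. (\<Phi> f, \<Psi> f))"
    using pair unfolding functional_pair_def by (intro continuous_map_pairedI) auto
  then have c: "continuous_map X euclidean (\<lambda>f. (\<Phi> f, \<Psi> f))" by simp
  have "open ({z::'k \<times> 'k. fst z \<noteq> 0} \<inter> (\<lambda>z. snd z / fst z) -` V)"
    by (intro continuous_open_preimage continuous_intros open_Collect_neq V) auto
  from openin_continuous_map_preimage[OF c, of "{z. fst z \<noteq> 0} \<inter> (\<lambda>z. snd z / fst z) -` V"] this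
  show ?th1 by (simp add: topspace_X)
  obtain v where "v \<in> V" using V by blast
  moreover obtain f where "f \<in> Cp_space p \<Omega>" "\<Phi> f = 1" "\<Psi> f = v"
    using pair unfolding functional_pair_def by blast
  ultimately show ?th2 by force
qed

text \<open>The unknown scalar cancels in the quotient; it is nonzero because the denominator is
  nonzero at the scaled vector.\<close>

lemma projectively_dense_ratio:
  assumes G: "projectively_dense G" and pair: "functional_pair \<Phi> \<Psi>" and V: "open V" "V \<noteq> {}"
  obtains g n where "g \<in> G" "\<Phi> ((T ^^ n) g) \<noteq> 0" "\<Psi> ((T ^^ n) g) / \<Phi> ((T ^^ n) g) \<in> V"
proof -
  obtain g n c where g: "g \<in> G"
    and m: "fun_scale c ((T ^^ n) g) \<in> {f \<in> Cp_space p \<Omega>. \<Phi> f \<noteq> 0 \<and> \<Psi> f / \<Phi> f \<in> V}"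
    using G openin_ratio[OF pair V] unfolding projectively_dense_def by meson
  have "(T ^^ n) g \<in> Cp_space p \<Omega>" using G g T_funpow_in unfolding projectively_dense_def by blast
  then have "\<Phi> (fun_scale c ((T ^^ n) g)) = c * \<Phi> ((T ^^ n) g)"
    "\<Psi> (fun_scale c ((T ^^ n) g)) = c * \<Psi> ((T ^^ n) g)"
    using pair unfolding functional_pair_def by blast+
  then show ?thesis using that[OF g, of n] m by auto
qed

text \<open>What a supercyclic and a transitive operator have in common: the class \<open>\<B>\<close> contains all
  singletons, for the orbit of one supercyclic vector, and some nonempty open set, for the orbits of
  the members of an open set.\<close>

definition richly_orbiting :: bool where
  "richly_orbiting \<longleftrightarrow>
    (\<forall>\<Phi> \<Psi> \<B>. functional_pair \<Phi> \<Psi> \<longrightarrow> (\<forall>z. {z} \<in> \<B>) \<longrightarrow> (\<exists>B\<in>\<B>. open B \<and> B \<noteq> {}) \<longrightarrow>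
      (\<exists>G. projectively_dense G \<and> (\<exists>B\<in>\<B>. \<forall>g\<in>G. \<Phi> g \<noteq> 0 \<longrightarrow> \<Psi> g / \<Phi> g \<in> B))) \<and>
    (\<forall>x\<in>\<Omega>. \<forall>k::nat. \<exists>G M. projectively_dense G \<and>
      (\<forall>g\<in>G. \<forall>i<k. g ((\<psi> ^^ i) x) \<noteq> 0 \<longrightarrow> norm (g ((\<psi> ^^ Suc i) x) / g ((\<psi> ^^ i) x)) \<le> M))"

lemma richly_orbitingD:
  assumes richly_orbiting "functional_pair \<Phi> \<Psi>" "\<And>z. {z} \<in> \<B>" "B0 \<in> \<B>" "open B0" "B0 \<noteq> {}"
  shows "\<exists>G. projectively_dense G \<and> (\<exists>B\<in>\<B>. \<forall>g\<in>G. \<Phi> g \<noteq> 0 \<longrightarrow> \<Psi> g / \<Phi> g \<in> B)"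
proof -
  have "\<forall>z. {z} \<in> \<B>" "\<exists>B\<in>\<B>. open B \<and> B \<noteq> {}" using assms by blast+
  then show ?thesis using assms(1,2) unfolding richly_orbiting_def by simp
qed

text \<open>With a single vector the quotient has a single starting value, and finitely many
  quotients are bounded by the sum of their norms.\<close>

lemma supercyclic_imp_richly_orbiting:
  assumes "supercyclic_on X fun_scale T"
  shows richly_orbiting
proof -
  obtain g where g: "g \<in> Cp_space p \<Omega>" "X closure_of {fun_scale c ((T ^^ n) g) | c n. True} = topspace X"
    using assms topspace_X unfolding supercyclic_on_def by auto
  have G: "projectively_dense {g}"
    unfolding projectively_dense_def using g unfolding dense_intersects_open by blast
  have "\<exists>G. projectively_dense G \<and> (\<exists>B\<in>\<B>. \<forall>g\<in>G. \<Phi> g \<noteq> 0 \<longrightarrow> \<Psi> g / \<Phi> g \<in> B)"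
    if "\<forall>z. {z} \<in> \<B>" for \<Phi> \<Psi> :: "(real \<Rightarrow> 'k) \<Rightarrow> 'k" and \<B>
    by (rule exI[of _ "{g}"]) (use G that in blast)
  moreover have "\<exists>G M. projectively_dense G \<and>
      (\<forall>g\<in>G. \<forall>i<k. g ((\<psi> ^^ i) x) \<noteq> 0 \<longrightarrow> norm (g ((\<psi> ^^ Suc i) x) / g ((\<psi> ^^ i) x)) \<le> M)" for x and k :: nat
  proof (intro exI conjI ballI allI impI)
    show "projectively_dense {g}" by (rule G)
    fix h i assume "h \<in> {g}" "i < k"
    then show "norm (h ((\<psi> ^^ Suc i) x) / h ((\<psi> ^^ i) x)) \<le>
        (\<Sum>i<k. norm (g ((\<psi> ^^ Suc i) x) / g ((\<psi> ^^ i) x)))"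
      using member_le_sum[of i "{..<k}" "\<lambda>i. norm (g ((\<psi> ^^ Suc i) x) / g ((\<psi> ^^ i) x))"] by simp
  qed
  ultimately show ?thesis unfolding richly_orbiting_def by blast
qed

text \<open>The vectors whose quotient lies in the given open set form a nonempty open set, whose
  orbits are dense by transitivity.\<close>

lemma transitive_imp_richly_orbiting:
  assumes "transitive_on X T"
  shows richly_orbiting
proof -
  have G: "projectively_dense U" if U: "openin X U" "U \<noteq> {}" for U
    unfolding projectively_dense_def
  proof (intro conjI allI impI)
    show "U \<subseteq> Cp_space p \<Omega>" using openin_subset[OF U(1)] topspace_X by blast
    fix V assume "openin X V \<and> V \<noteq> {}"
    then obtain n g where "g \<in> U" "(T ^^ n) g \<in> V"
      using assms U unfolding transitive_on_def by blast
    then show "\<exists>g\<in>U. \<exists>n c. fun_scale c ((T ^^ n) g) \<in> V"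
      by (intro bexI[of _ g] exI[of _ n] exI[of _ 1]) auto
  qed
  have "\<exists>G. projectively_dense G \<and> (\<exists>B\<in>\<B>. \<forall>g\<in>G. \<Phi> g \<noteq> 0 \<longrightarrow> \<Psi> g / \<Phi> g \<in> B)"
    if pair: "functional_pair \<Phi> \<Psi>" and B: "\<exists>B\<in>\<B>. open B \<and> B \<noteq> {}" for \<Phi> \<Psi> \<B>
  proof -
    obtain B where "B \<in> \<B>" "open B" "B \<noteq> {}" using B by blast
    then show ?thesis using G[OF openin_ratio[OF pair, of B]] by blast
  qed
  moreover have "\<exists>G M. projectively_dense G \<and>
      (\<forall>g\<in>G. \<forall>i<k. g ((\<psi> ^^ i) x) \<noteq> 0 \<longrightarrow> norm (g ((\<psi> ^^ Suc i) x) / g ((\<psi> ^^ i) x)) \<le> M)"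
    if x: "x \<in> \<Omega>" for x and k :: nat
  proof -
    \<comment> \<open>Functions within 1/2 of the constant 1 at the first points of the orbit of
      \<open>x\<close>; their successive quotients have norm at most (3/2) / (1/2) = 3.\<close>
    define U where "U = (\<Inter>i\<in>{..k}. {f \<in> topspace X. f ((\<psi> ^^ i) x) \<in> ball 1 (1/2)})"
    have "openin X U" unfolding U_def
      by (intro openin_INT2 openin_continuous_map_preimage[OF continuous_map_eval] \<psi>_funpow_in x) auto
    moreover have "extend0 \<Omega> (pfun 1) \<in> U"
    proof -
      have "extend0 \<Omega> (pfun 1) ((\<psi> ^^ i) x) = (1::'k)" for i
        using \<psi>_funpow_in[OF x] by (simp add: extend0_def pfun_def)
      then show ?thesis using extend0_pfun_in[of "1 :: 'k poly"] by (simp add: U_def topspace_X)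
    qed
    ultimately have "projectively_dense U" using G by blast
    moreover have "norm (g ((\<psi> ^^ Suc i) x) / g ((\<psi> ^^ i) x)) \<le> 3"
      if g: "g \<in> U" and i: "i < k" and nz: "g ((\<psi> ^^ i) x) \<noteq> 0" for g i
    proof -
      have "dist 1 (g ((\<psi> ^^ Suc i) x)) < 1/2" "dist 1 (g ((\<psi> ^^ i) x)) < 1/2"
        using g i unfolding U_def by (auto simp del: funpow.simps)
      then have "norm (g ((\<psi> ^^ Suc i) x)) \<le> 3/2" "norm (g ((\<psi> ^^ i) x)) \<ge> 1/2"
        using norm_triangle_ineq2[of "g ((\<psi> ^^ Suc i) x)" 1] norm_triangle_ineq2[of 1 "g ((\<psi> ^^ i) x)"]
        by (auto simp: dist_norm norm_minus_commute simp del: funpow.simps)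
      then show ?thesis using nz by (simp add: norm_divide divide_le_eq del: funpow.simps)
    qed
    ultimately show ?thesis by blast
  qed
  ultimately show ?thesis unfolding richly_orbiting_def by blast
qed

lemma norm_gt_open: "open {z::'k. M < norm z}" "{z::'k. M < norm z} \<noteq> {}"
proof -
  show "open {z::'k. M < norm z}" by (intro open_Collect_less continuous_intros)
  have "of_real (\<bar>M\<bar> + 1) \<in> {z::'k. M < norm z}" by simp
  then show "{z::'k. M < norm z} \<noteq> {}" by blast
qed

text \<open>Common source of three obstructions. The bounded sets are an admissible class of
  starting values, and any later quotient is a quotient after one application of \<open>T\<close>;
  together they miss the open set of scalars of norm above both bounds.\<close>

lemma ratio_after_T_unbounded:
  assumes R: richly_orbiting and pair: "functional_pair \<Phi> \<Psi>"
    and C: "\<And>f. f \<in> Cp_space p \<Omega> \<Longrightarrow> \<Phi> (T f) \<noteq> 0 \<Longrightarrow> norm (\<Psi> (T f) / \<Phi> (T f)) \<le> C"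
  shows False
proof -
  have "\<exists>G. projectively_dense G \<and> (\<exists>B\<in>Collect bounded. \<forall>g\<in>G. \<Phi> g \<noteq> 0 \<longrightarrow> \<Psi> g / \<Phi> g \<in> B)"
    using richly_orbitingD[OF R pair, of "Collect bounded" "ball 0 1"] by simp
  then obtain G B where G: "projectively_dense G" and "bounded B"
    and B: "\<And>g. g \<in> G \<Longrightarrow> \<Phi> g \<noteq> 0 \<Longrightarrow> \<Psi> g / \<Phi> g \<in> B"
    by auto
  then obtain M where M: "\<And>z. z \<in> B \<Longrightarrow> norm z \<le> M" using bounded_iff by blast
  obtain g n where g: "g \<in> G" "\<Phi> ((T ^^ n) g) \<noteq> 0"
    "\<Psi> ((T ^^ n) g) / \<Phi> ((T ^^ n) g) \<in> {z. max M C < norm z}"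
    using projectively_dense_ratio[OF G pair norm_gt_open] by blast
  show False
  proof (cases n)
    \<comment> \<open>The only time not covered by \<open>C\<close>; here the starting values in
      \<open>B\<close> decide.\<close>
    case 0
    then show ?thesis using g M[OF B[of g]] by auto
  next
    case (Suc m)
    have "(T ^^ m) g \<in> Cp_space p \<Omega>" using G g T_funpow_in unfolding projectively_dense_def by blast
    from C[OF this] show ?thesis using g Suc by auto
  qed
qed

section \<open>The conditions on weight and symbol\<close>

lemma T_apply: "x \<in> \<Omega> \<Longrightarrow> T f x = \<omega> x * f (\<psi> x)"
  by (simp add: weighted_comp_def)

text \<open>At a zero of the weight every \<open>T f\<close> vanishes, so the bound on the quotients
  f(y)/f(x) after one step holds vacuously.\<close>

lemma weight_nonzero:
  assumes R: richly_orbiting and x: "x \<in> \<Omega>"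
  shows "\<omega> x \<noteq> 0"
proof
  assume "\<omega> x = 0"
  obtain y where y: "y \<in> \<Omega>" "y \<noteq> x"
  proof -
    have "\<Omega> \<noteq> {x}" using open_\<Omega> not_open_singleton[of x] by metis
    then show ?thesis using x that by blast
  qed
  show False
    by (rule ratio_after_T_unbounded[OF R functional_pair_points[OF x y(1)], of 0])
       (use y \<open>\<omega> x = 0\<close> x in \<open>auto simp: T_apply\<close>)
qed

text \<open>If two points have the same image, the quotient after one step is the constant ratio of
  the weights.\<close>

lemma symbol_inj:
  assumes R: richly_orbiting
  shows "inj_on \<psi> \<Omega>"
proof (rule inj_onI, rule ccontr)
  fix x y assume xy: "x \<in> \<Omega>" "y \<in> \<Omega>" "\<psi> x = \<psi> y" "x \<noteq> y"
  show False
    by (rule ratio_after_T_unbounded[OF R functional_pair_points[OF xy(1,2,4)], of "norm (\<omega> y / \<omega> x)"])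
       (use xy in \<open>auto simp: T_apply\<close>)
qed

lemma T_has_vector_derivative:
  assumes f: "f \<in> Cp_space p \<Omega>" and x: "x \<in> \<Omega>"
  shows "(T f has_vector_derivative \<omega> x * (vector_derivative \<psi> (at x) *\<^sub>R vector_derivative f (at (\<psi> x)))
    + vector_derivative \<omega> (at x) * f (\<psi> x)) (at x)"
proof -
  have \<psi>x: "\<psi> x \<in> \<Omega>" using x \<psi>_\<Omega> by blast
  have "((\<lambda>x. f (\<psi> x)) has_vector_derivative
      vector_derivative \<psi> (at x) *\<^sub>R vector_derivative f (at (\<psi> x))) (at x)"
    using vector_diff_chain_at[OF Cp_on_has_vector_derivative[OF Cp_\<psi> x p_ge_1]
        Cp_space_has_vector_derivative[OF f \<psi>x]] by (simp add: o_def)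
  from has_vector_derivative_mult[OF Cp_on_has_vector_derivative[OF Cp_\<omega> x p_ge_1] this]
  have "((\<lambda>x. \<omega> x * f (\<psi> x)) has_vector_derivative
      \<omega> x * (vector_derivative \<psi> (at x) *\<^sub>R vector_derivative f (at (\<psi> x)))
      + vector_derivative \<omega> (at x) * f (\<psi> x)) (at x)" .
  then show ?thesis
    unfolding has_vector_derivative_def
    by (rule has_derivative_transform_within_open[OF _ open_\<Omega> x]) (simp add: T_apply)
qed

text \<open>At a critical point the term with f' drops out, and the logarithmic derivative of
  \<open>T f\<close> is the constant logarithmic derivative of the weight.\<close>

lemma symbol_deriv_nonzero:
  assumes R: richly_orbiting and x: "x \<in> \<Omega>"
  shows "vector_derivative \<psi> (at x) \<noteq> 0"
proof
  assume 0: "vector_derivative \<psi> (at x) = 0"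
  show False
    by (rule ratio_after_T_unbounded[OF R functional_pair_jet[OF x], of "norm (vector_derivative \<omega> (at x) / \<omega> x)"])
       (use 0 x in \<open>auto simp: T_apply vector_derivative_at[OF T_has_vector_derivative]\<close>)
qed

text \<open>At a fixed point \<open>T\<close> acts on the logarithmic derivative r = f'(x)/f(x) by r
  |-> c + a r, where c is the logarithmic derivative of the weight and a the multiplier of the fixed
  point.\<close>

lemma symbol_no_fixpoint:
  assumes R: richly_orbiting and x: "x \<in> \<Omega>"
  shows "\<psi> x \<noteq> x"
proof
  assume fp: "\<psi> x = x"
  define c where "c = vector_derivative \<omega> (at x) / \<omega> x"
  define a where "a = vector_derivative \<psi> (at x)"
  define A where "A = (\<lambda>z::'k. c + a *\<^sub>R z)"
  define r where "r = (\<lambda>f :: real \<Rightarrow> 'k. vector_derivative f (at x) / f x)"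
  \<comment> \<open>Exactly the sets of starting values to which
    \<open>affine_orbit_not_dense\<close> applies. Every singleton qualifies, with the norm of its
    own nonzero displacement as \<open>\<epsilon>\<close>, or with 1.\<close>
  define \<B> where "\<B> = {B. bounded B \<and> (\<exists>\<epsilon>>0. \<forall>z\<in>B. c + (a - 1) *\<^sub>R z = 0 \<or> \<epsilon> \<le> norm (c + (a - 1) *\<^sub>R z))}"
  have "{z} \<in> \<B>" for z
    unfolding \<B>_def
    by (cases "c + (a - 1) *\<^sub>R z = 0")
       (auto intro: exI[of _ 1] exI[of _ "norm (c + (a - 1) *\<^sub>R z)"])
  moreover obtain B0 where "B0 \<in> \<B>" "open B0" "B0 \<noteq> {}"
    using ex_open_affine_separated[of c a] unfolding \<B>_def by blast
  ultimately have "\<exists>G. projectively_dense G \<and> (\<exists>B\<in>\<B>. \<forall>g\<in>G. g x \<noteq> 0 \<longrightarrow> r g \<in> B)"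
    unfolding r_def by (intro richly_orbitingD[OF R functional_pair_jet[OF x]])
  then obtain G B where G: "projectively_dense G" and "B \<in> \<B>"
    and B: "\<And>g. g \<in> G \<Longrightarrow> g x \<noteq> 0 \<Longrightarrow> r g \<in> B" by blast
  from \<open>B \<in> \<B>\<close> obtain \<epsilon> where "bounded B" "\<epsilon> > 0"
    "\<And>z. z \<in> B \<Longrightarrow> c + (a - 1) *\<^sub>R z = 0 \<or> \<epsilon> \<le> norm (c + (a - 1) *\<^sub>R z)"
    unfolding \<B>_def by blast
  from affine_orbit_not_dense[OF this]
  obtain V where "open V \<and> V \<noteq> {} \<and> (\<forall>z\<in>B. \<forall>n. (A ^^ n) z \<notin> V)"
    unfolding A_def ..
  then have V: "open V" "V \<noteq> {}" "\<And>z n. z \<in> B \<Longrightarrow> (A ^^ n) z \<notin> V" by simp_all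
  obtain g n where g: "g \<in> G" "(T ^^ n) g x \<noteq> 0" "r ((T ^^ n) g) \<in> V"
    using projectively_dense_ratio[OF G functional_pair_jet[OF x] V(1,2)] unfolding r_def by metis
  have gX: "g \<in> Cp_space p \<Omega>" using G g unfolding projectively_dense_def by blast
  have "(T ^^ m) g x \<noteq> 0 \<Longrightarrow> g x \<noteq> 0 \<and> r ((T ^^ m) g) = (A ^^ m) (r g)" for m
  proof (induction m)
    case (Suc m)
    let ?f = "(T ^^ m) g"
    have f: "?f \<in> Cp_space p \<Omega>" using gX T_funpow_in by blast
    have nz: "\<omega> x \<noteq> 0" "?f x \<noteq> 0" using Suc.prems by (auto simp: T_apply[OF x] fp)
    then have "r (T ?f) = A (r ?f)"
      unfolding r_def A_def c_def a_def vector_derivative_at[OF T_has_vector_derivative[OF f x]]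
      by (simp add: T_apply[OF x] fp field_simps)
    then show ?case using Suc.IH[OF nz(2)] by simp
  qed simp
  then show False using g V(3) B by metis
qed

text \<open>With fixed points excluded, \<open>x\<close> and its image are distinct. Along a cycle
  the weights of two neighbouring points share all factors but one, so the quotient of the values is
  a product of two factors that range over bounded sets.\<close>

lemma symbol_no_periodic:
  assumes R: richly_orbiting and x: "x \<in> \<Omega>" and "n \<ge> 1"
  shows "(\<psi> ^^ n) x \<noteq> x"
proof
  assume per: "(\<psi> ^^ n) x = x"
  define y where "y = (\<lambda>i. (\<psi> ^^ i) x)"
  have y\<Omega>: "y i \<in> \<Omega>" for i unfolding y_def using \<psi>_funpow_in[OF x] .
  have ymod: "y (m mod n) = y m" for m unfolding y_def using funpow_mod_eq[OF per] .
  have y0: "y 0 = x" by (simp add: y_def)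
  obtain G M where G: "projectively_dense G"
    and M: "\<And>g i. g \<in> G \<Longrightarrow> i < n \<Longrightarrow> g (y i) \<noteq> 0 \<Longrightarrow> norm (g (y (Suc i)) / g (y i)) \<le> M"
    using R x unfolding richly_orbiting_def y_def by metis
  define C where "C = (\<Sum>i<n. norm (\<omega> (y i) / \<omega> x))"
  have C: "norm (\<omega> (y m) / \<omega> x) \<le> C" for m
    using member_le_sum[of "m mod n" "{..<n}" "\<lambda>i. norm (\<omega> (y i) / \<omega> x)"] \<open>n \<ge> 1\<close>
    unfolding C_def by (simp add: ymod)
  have "functional_pair (\<lambda>f. f x) (\<lambda>f. f (\<psi> x))"
    using functional_pair_points[OF x] x \<psi>_\<Omega> symbol_no_fixpoint[OF R x] by (metis image_subset_iff)
  then obtain g m where g: "g \<in> G" "(T ^^ m) g x \<noteq> 0"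
    "(T ^^ m) g (\<psi> x) / (T ^^ m) g x \<in> {z. C * M < norm z}"
    using projectively_dense_ratio[OF G _ norm_gt_open] by metis
  have gX: "g \<in> Cp_space p \<Omega>" using G g unfolding projectively_dense_def by blast
  have \<psi>x: "\<psi> x \<in> \<Omega>" using x \<psi>_\<Omega> by blast
  have Tx: "(T ^^ m) g x = W m x * g (y m)" using x by (simp add: T_funpow_apply[OF gX] y_def)
  have T\<psi>x: "(T ^^ m) g (\<psi> x) = W m (\<psi> x) * g (y (Suc m))"
    using \<psi>x by (simp add: T_funpow_apply[OF gX] y_def funpow_swap1)
  have nz: "W m x \<noteq> 0" "g (y m) \<noteq> 0" using g(2) Tx by auto
  have \<omega>x: "\<omega> x \<noteq> 0" by (rule weight_nonzero[OF R x])
  \<comment> \<open>Both sides are \<open>W (Suc m) x\<close>, with the first or the last factor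
    split off.\<close>
  have "\<omega> x * W m (\<psi> x) = W m x * \<omega> (y m)"
    using W_Suc[of m x] W_add[of m 1 x] by (simp add: y_def W_def[of "Suc 0"])
  then have "W m (\<psi> x) = W m x * \<omega> (y m) / \<omega> x" using \<omega>x by (simp add: field_simps)
  then have eq: "(T ^^ m) g (\<psi> x) / (T ^^ m) g x = (\<omega> (y m) / \<omega> x) * (g (y (Suc m)) / g (y m))"
    unfolding Tx T\<psi>x using nz by simp
  \<comment> \<open>\<open>Suc (m mod n)\<close> may equal \<open>n\<close>, where the orbit is back
    at \<open>x\<close>; hence the quotients with index below \<open>n\<close> cover all
    \<open>m\<close>.\<close>
  have "y (Suc (m mod n)) = y (Suc m)" using ymod[of m] by (simp add: y_def)
  then have "norm (g (y (Suc m)) / g (y m)) \<le> M"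
    using M[OF g(1), of "m mod n"] nz \<open>n \<ge> 1\<close> by (simp add: ymod)
  moreover have "0 \<le> C" unfolding C_def by (intro sum_nonneg) auto
  ultimately have "norm ((T ^^ m) g (\<psi> x) / (T ^^ m) g x) \<le> C * M"
    unfolding eq norm_mult using C by (intro mult_mono) auto
  then show False using g(3) by auto
qed

lemma richly_orbiting_imp_runaway:
  assumes R: richly_orbiting
  shows "runaway_weighted_composition \<Omega> p \<psi> \<omega>"
  using weight_nonzero[OF R] symbol_inj[OF R] symbol_deriv_nonzero[OF R] symbol_no_periodic[OF R]
  by unfold_locales auto

text \<open>Mixing and chaos enter through transitivity. Each property thus yields
  \<open>richly_orbiting\<close>, hence the conditions on weight and symbol, and these give all
  three properties.\<close>

lemma equivalences:
  "supercyclic_on X fun_scale T \<longleftrightarrow> mixing_on X T"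
  "supercyclic_on X fun_scale T \<longleftrightarrow> chaotic_on X T"
proof -
  have "mixing_on X T \<Longrightarrow> transitive_on X T"
    unfolding mixing_on_def transitive_on_def by (meson order_refl)
  moreover have "chaotic_on X T \<Longrightarrow> transitive_on X T" by (simp add: chaotic_on_def)
  moreover have "richly_orbiting \<Longrightarrow> supercyclic_on X fun_scale T \<and> mixing_on X T \<and> chaotic_on X T"
    using richly_orbiting_imp_runaway runaway_weighted_composition.supercyclic
      runaway_weighted_composition.mixing runaway_weighted_composition.chaotic by metis
  ultimately show "supercyclic_on X fun_scale T \<longleftrightarrow> mixing_on X T"
    "supercyclic_on X fun_scale T \<longleftrightarrow> chaotic_on X T"
    using supercyclic_imp_richly_orbiting transitive_imp_richly_orbiting by blast+
qed

end

theorem theorem4p1: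
  fixes \<Omega> :: "real set" and p :: enat and \<psi> :: "real \<Rightarrow> real"
  assumes "open \<Omega>" and "\<Omega> \<noteq> {}"
    and "p \<ge> 1"
    and "Cp_on p \<Omega> \<psi>" and "\<psi> ` \<Omega> \<subseteq> \<Omega>"
  shows
    "(\<forall>\<omega> :: real \<Rightarrow> real. Cp_on p \<Omega> \<omega> \<longrightarrow>
        (supercyclic_on (Cp_topology p \<Omega>) fun_scale (weighted_comp \<Omega> \<omega> \<psi>)
           \<longleftrightarrow> mixing_on (Cp_topology p \<Omega>) (weighted_comp \<Omega> \<omega> \<psi>)) \<and>
        (supercyclic_on (Cp_topology p \<Omega>) fun_scale (weighted_comp \<Omega> \<omega> \<psi>)
           \<longleftrightarrow> chaotic_on (Cp_topology p \<Omega>) (weighted_comp \<Omega> \<omega> \<psi>))) \<and>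
     (\<forall>\<omega> :: real \<Rightarrow> complex. Cp_on p \<Omega> \<omega> \<longrightarrow>
        (supercyclic_on (Cp_topology p \<Omega>) fun_scale (weighted_comp \<Omega> \<omega> \<psi>)
           \<longleftrightarrow> mixing_on (Cp_topology p \<Omega>) (weighted_comp \<Omega> \<omega> \<psi>)) \<and>
        (supercyclic_on (Cp_topology p \<Omega>) fun_scale (weighted_comp \<Omega> \<omega> \<psi>)
           \<longleftrightarrow> chaotic_on (Cp_topology p \<Omega>) (weighted_comp \<Omega> \<omega> \<psi>)))"
proof -
  \<comment> \<open>The locale is generic in the scalar field; only the premise on the weight
    remains, and it is discharged for real and complex weights separately.\<close>
  note intro = weighted_composition.intro[OF assms]
  show ?thesis
    by (intro conjI allI impI) (rule weighted_composition.equivalences[OF intro], assumption)+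
qed

end
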